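(* Let $T_d$ denote the $(d+1)$-regular infinite tree. (i) Let $2\le k\le d$ be integers. The critical probability $p(T_d,k)$ is the supremum of all $p\in[0,1]$ for which the equation $$\mathbb{P}\bigl(\mathrm{Binom}(d,(1-x)(1-p))\le d-k\bigr)=x$$ has a real root $x\in(0,1)$. (ii) For any constant $\gamma\in[0,1]$ and any sequence of integers $k_d$ (with $2\le k_d\le d$) such that $\lim_{d\to\infty}k_d/d=\gamma$, $$\lim_{d\to\infty}p(T_d,k_d)=\gamma.$$ (iii) For every integer $d\ge 2$, $$p(T_d,d)=1-\frac1d\qquad\text{and}\qquad p(T_d,2)=1-\frac{(d-1)^{2d-3}}{d^{d-1}(d-2)^{d-2}}$$ (with the convention $0^0=1$), and moreover $p(T_d,2)\sim \frac{1}{2d^2}$ as $d\to\infty$.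
   Context: Bootstrap percolation with the $k$-neighbor rule ($k$-rule) on a countable, connected, locally finite graph $G=(V,E)$: initially each vertex is occupied with probability $p$ and vacant with probability $1-p$, independently of each other (law $\mathbb{P}_p$). Then a deterministic rule is iterated in discrete time: if a vacant vertex has at least $k$ occupied neighbors at some time step, it becomes occupied in the next step; occupied vertices remain occupied. Complete occupation is the event that every vertex eventually becomes occupied. For an infinite graph $G$, the critical probability is $p(G,k)=\inf\{p\in[0,1] : \mathbb{P}_p(\text{complete occupation})>0\}$. $\mathrm{Binom}(n,s)$ denotes a binomial random variable with $n$ trials and success probability $s$. The notation $a_d\sim b_d$ means $a_d/b_d\to1$. *)

theory Defs
  imports "HOL-Probability.Probability" "HOL-Library.Landau_Symbols"
begin

section \<open>Simple graphs and regular trees\<close>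

text \<open>
  Graphs are undirected and simple, with vertex set and edge set of arbitrary cardinality.
  (The digraph-based notion of a tree in the AFP entry \<open>Graph_Theory\<close> forbids directed cycles,
  and \<open>a, b, a\<close> is one in a symmetric digraph, so it is not the undirected notion.)
\<close>

record 'v ugraph =
  verts :: "'v set"
  edges :: "'v set set"

definition simple_graph :: "'v ugraph \<Rightarrow> bool" where
  "simple_graph G \<longleftrightarrow>
     (\<forall>e\<in>edges G. \<exists>u v. u \<in> verts G \<and> v \<in> verts G \<and> u \<noteq> v \<and> e = {u, v})"

definition adjacent :: "'v ugraph \<Rightarrow> 'v \<Rightarrow> 'v \<Rightarrow> bool" where
  "adjacent G u v \<longleftrightarrow> {u, v} \<in> edges G"

definition neighbors :: "'v ugraph \<Rightarrow> 'v \<Rightarrow> 'v set" where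
  "neighbors G v = {u. adjacent G v u}"

definition connected_graph :: "'v ugraph \<Rightarrow> bool" where
  "connected_graph G \<longleftrightarrow>
     verts G \<noteq> {} \<and> (\<forall>u\<in>verts G. \<forall>v\<in>verts G. (adjacent G)\<^sup>*\<^sup>* u v)"

text \<open>A cycle is given by the list of its distinct vertices in cyclic order.\<close>

definition is_cycle :: "'v ugraph \<Rightarrow> 'v list \<Rightarrow> bool" where
  "is_cycle G c \<longleftrightarrow>
     length c \<ge> 3 \<and> distinct c \<and> successively (adjacent G) c \<and> adjacent G (last c) (hd c)"

definition tree :: "'v ugraph \<Rightarrow> bool" where
  "tree G \<longleftrightarrow> simple_graph G \<and> connected_graph G \<and> (\<nexists>c. is_cycle G c)"

text \<open>\<open>finite\<close> is required separately because \<open>card\<close> of an infinite set is \<open>0\<close>.\<close>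

definition regular :: "nat \<Rightarrow> 'v ugraph \<Rightarrow> bool" where
  "regular r G \<longleftrightarrow> (\<forall>v\<in>verts G. finite (neighbors G v) \<and> card (neighbors G v) = r)"

definition infinite_regular_tree :: "nat \<Rightarrow> 'v ugraph \<Rightarrow> bool" where
  "infinite_regular_tree r G \<longleftrightarrow> tree G \<and> infinite (verts G) \<and> regular r G"


section \<open>Bootstrap percolation\<close>

text \<open>
  \<open>occupied G k A n\<close> is the set of vertices occupied at time \<open>n\<close> under the \<open>k\<close>-neighbor rule,
  when \<open>A\<close> is the set of initially occupied vertices. It is meant for locally finite graphs:
  at a vertex of infinite degree \<open>card\<close> would not count the occupied neighbors.
\<close>

primrec occupied :: "'v ugraph \<Rightarrow> nat \<Rightarrow> 'v set \<Rightarrow> nat \<Rightarrow> 'v set" where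
  "occupied G k A 0 = A"
| "occupied G k A (Suc n) =
     occupied G k A n \<union> {v \<in> verts G. k \<le> card (neighbors G v \<inter> occupied G k A n)}"

text \<open>The law of the initial configuration; \<open>\<omega> v\<close> says that \<open>v\<close> is initially occupied.\<close>

definition initial_law :: "'v ugraph \<Rightarrow> real \<Rightarrow> ('v \<Rightarrow> bool) measure" where
  "initial_law G p = (\<Pi>\<^sub>M v\<in>verts G. measure_pmf (bernoulli_pmf p))"

definition complete_occupation :: "'v ugraph \<Rightarrow> nat \<Rightarrow> real \<Rightarrow> ('v \<Rightarrow> bool) set" where
  "complete_occupation G k p =
     {\<omega> \<in> space (initial_law G p). \<forall>v\<in>verts G. \<exists>n. v \<in> occupied G k {u \<in> verts G. \<omega> u} n}"

definition critical_probability :: "'v ugraph \<Rightarrow> nat \<Rightarrow> real" where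
  "critical_probability G k =
     Inf {p \<in> {0..1}. measure (initial_law G p) (complete_occupation G k p) > 0}"

end

theory Submission
  imports Defs "HOL-Real_Asymp.Real_Asymp"
begin

text \<open>
  Write \<open>m = d - k + 1\<close> and \<open>F z = P(Binom(d, z) \<ge> m)\<close>. A vertex with one neighbor disregarded has \<open>d\<close>
  remaining neighbors, its children; if initially vacant, it stays so as long as at least \<open>m\<close> of these
  do. In a tree the branches behind the children are disjoint, so their fates are independent. Hence
  the probability \<open>q n\<close> that a vertex, cut off from one of its neighbors, is vacant at time \<open>n - 1\<close>
  satisfies \<open>q (n + 1) = (1 - p) F (q n)\<close>, with \<open>q 0 = 1\<close>, and it decreases to the largest fixed point
  \<open>q\<close> of \<open>z \<mapsto> (1 - p) F z\<close> on \<open>[0, 1]\<close>. The recursion rests on the lemma \<open>branch_events_step\<close>.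

  If \<open>0\<close> is the only fixed point, every vertex is occupied eventually, almost surely, since cutting
  off a neighbor can only delay occupation (\<open>complete_occupation_almost_surely\<close>). If \<open>q > 0\<close>, then a
  vacant vertex with \<open>m + 1\<close> children that remain vacant in their branches for ever lies in a set of
  vacant vertices each of which has at least \<open>m + 1\<close> neighbors in the set, hence at most \<open>k - 1\<close>
  outside; no vertex of it is ever occupied. Such a vertex occurs with positive probability
  at the root of any given branch, and there are \<open>d ^ n\<close> disjoint branches at depth \<open>n\<close>, so one occurs almost
  surely (\<open>complete_occupation_null\<close>).

  So the critical probability is the supremum of all \<open>p\<close> for which \<open>z = (1 - p) F z\<close> has a root in
  \<open>(0, 1)\<close>; the fixed point \<open>1\<close> occurs for \<open>p = 0\<close> only. The substitution \<open>z = (1 - x) (1 - p)\<close> turns this equation into the one with \<open>x\<close>. Solving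
  for \<open>p\<close> instead of \<open>z\<close> parametrizes the set as \<open>{1 - z / F z | 0 < z < 1, z \<le> F z}\<close>, the set
  \<open>critical_values\<close>, and makes its supremum accessible:
  \<^item> Markov's inequality \<open>m F z \<le> d z\<close> bounds it by \<open>1 - m / d = (k - 1) / d\<close>.
  \<^item> By Hoeffding's inequality \<open>F z\<close> is close to \<open>1\<close> once \<open>z\<close> exceeds \<open>m / d\<close> by a constant, so the
    supremum is at least \<open>1 - m / d - o(1)\<close>. Together these give the limit \<open>\<gamma>\<close>.
  \<^item> For \<open>k = d\<close> the Markov bound is approached as \<open>z\<close> tends to \<open>0\<close>.
  \<^item> For \<open>k = 2 < d\<close> one has \<open>F z / z = z ^ (d - 2) (d - (d - 1) z)\<close>, whose maximum is at
    \<open>z = d (d - 2) / (d - 1)\<^sup>2\<close>.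
\<close>

section \<open>Tails of the binomial distribution\<close>

text \<open>
  The upper tail as an explicit polynomial, so that continuity and the recursion in \<open>n\<close> are at hand.
\<close>
definition binomial_tail :: "nat \<Rightarrow> nat \<Rightarrow> real \<Rightarrow> real" where
  "binomial_tail n j z = (\<Sum>i=j..n. real (n choose i) * z ^ i * (1 - z) ^ (n - i))"

lemma isCont_binomial_tail: "isCont (binomial_tail n j) z"
  unfolding binomial_tail_def by (intro continuous_intros)

lemma binomial_tail_eq_prob:
  assumes "0 \<le> z" "z \<le> 1"
  shows "binomial_tail n j z = measure_pmf.prob (binomial_pmf n z) {j..}"
proof -
  have "set_pmf (binomial_pmf n z) \<subseteq> {..n}"
    using assms by (auto simp: set_pmf_binomial_eq)
  then have *: "{j..n} \<inter> set_pmf (binomial_pmf n z) = {j..} \<inter> set_pmf (binomial_pmf n z)"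
    by auto
  have "binomial_tail n j z = measure_pmf.prob (binomial_pmf n z) {j..n}"
    using assms by (simp add: binomial_tail_def measure_measure_pmf_finite)
  also have "\<dots> = measure_pmf.prob (binomial_pmf n z) {j..}"
    by (metis * measure_Int_set_pmf)
  finally show ?thesis .
qed

lemma prob_binomial_le_eq:
  assumes "0 \<le> z" "z \<le> 1"
  shows "measure_pmf.prob (binomial_pmf n z) {i. i \<le> j} = 1 - binomial_tail n (Suc j) z"
proof -
  have "measure_pmf.prob (binomial_pmf n z) {i. i \<le> j}
      = measure_pmf.prob (binomial_pmf n z) (space (measure_pmf (binomial_pmf n z)) - {Suc j..})"
    by (rule arg_cong[where f = "measure_pmf.prob (binomial_pmf n z)"]) auto
  also have "\<dots> = 1 - measure_pmf.prob (binomial_pmf n z) {Suc j..}"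
    by (rule measure_pmf.prob_compl) simp
  finally show ?thesis using binomial_tail_eq_prob[OF assms] by simp
qed

lemma binomial_tail_0 [simp]: "binomial_tail n 0 z = 1"
  using binomial_ring[of z "1 - z" n] by (simp add: binomial_tail_def atMost_atLeast0)

lemma binomial_tail_0_Suc [simp]: "binomial_tail 0 (Suc j) z = 0"
  by (simp add: binomial_tail_def)

lemma binomial_tail_at_0: "0 < j \<Longrightarrow> binomial_tail n j 0 = 0"
  by (simp add: binomial_tail_def)

text \<open>
  Condition on the outcome of one of the trials.
\<close>
lemma binomial_tail_Suc_Suc:
  "binomial_tail (Suc n) (Suc j) z = z * binomial_tail n j z + (1 - z) * binomial_tail n (Suc j) z"
proof (cases "j \<le> n")
  case True
  have "(\<Sum>i=j..n. real (n choose Suc i) * z ^ Suc i * (1 - z) ^ (n - i))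
      = (\<Sum>i=Suc j..Suc n. real (n choose i) * z ^ i * (1 - z) ^ (Suc n - i))"
    by (subst sum.shift_bounds_cl_Suc_ivl) simp
  also have "\<dots> = (\<Sum>i=Suc j..n. real (n choose i) * z ^ i * (1 - z) ^ (Suc n - i))"
    using True by simp
  also have "\<dots> = (1 - z) * binomial_tail n (Suc j) z"
    unfolding binomial_tail_def sum_distrib_left
    by (rule sum.cong) (auto simp: Suc_diff_le)
  finally have 1: "(\<Sum>i=j..n. real (n choose Suc i) * z ^ Suc i * (1 - z) ^ (n - i))
      = (1 - z) * binomial_tail n (Suc j) z" .
  have "binomial_tail (Suc n) (Suc j) z
      = (\<Sum>i=j..n. real (Suc n choose Suc i) * z ^ Suc i * (1 - z) ^ (n - i))"
    unfolding binomial_tail_def by (subst sum.shift_bounds_cl_Suc_ivl) simp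
  also have "\<dots> = z * binomial_tail n j z
      + (\<Sum>i=j..n. real (n choose Suc i) * z ^ Suc i * (1 - z) ^ (n - i))"
    unfolding binomial_tail_def sum_distrib_left sum.distrib[symmetric]
    by (rule sum.cong) (auto simp: algebra_simps)
  finally show ?thesis using 1 by simp
qed (simp add: binomial_tail_def)

lemma binomial_tail_nonneg: "0 \<le> z \<Longrightarrow> z \<le> 1 \<Longrightarrow> 0 \<le> binomial_tail n j z"
  unfolding binomial_tail_def by (intro sum_nonneg) simp

lemma binomial_tail_antimono:
  assumes "0 \<le> z" "z \<le> 1" "i \<le> j"
  shows "binomial_tail n j z \<le> binomial_tail n i z"
  unfolding binomial_tail_def using assms by (intro sum_mono2) auto

lemma binomial_tail_le_1: "0 \<le> z \<Longrightarrow> z \<le> 1 \<Longrightarrow> binomial_tail n j z \<le> 1"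
  using binomial_tail_antimono[of z 0 j n] by simp

lemma binomial_tail_pos:
  assumes "0 < z" "z \<le> 1" "j \<le> n"
  shows "0 < binomial_tail n j z"
proof -
  have "z ^ n = binomial_tail n n z" by (simp add: binomial_tail_def)
  also have "\<dots> \<le> binomial_tail n j z" using assms by (intro binomial_tail_antimono) auto
  finally show ?thesis using assms by (smt (verit) zero_less_power)
qed

text \<open>
  In the recursion \<open>binomial_tail_Suc_Suc\<close> the success of the singled-out trial leads to the larger of the
  two tails, so raising the weight of success raises the tail.
\<close>
lemma binomial_tail_mono:
  assumes "0 \<le> x" "x \<le> y" "y \<le> 1"
  shows "binomial_tail n j x \<le> binomial_tail n j y"
proof (induction n arbitrary: j)
  case 0
  show ?case by (cases j) auto
next
  case (Suc n)
  show ?case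
  proof (cases j)
    case (Suc i)
    have "binomial_tail n (Suc i) x \<le> binomial_tail n i x"
      using assms by (intro binomial_tail_antimono) auto
    then have "x * (binomial_tail n i x - binomial_tail n (Suc i) x)
        \<le> y * (binomial_tail n i x - binomial_tail n (Suc i) x)"
      using assms by (intro mult_right_mono) auto
    then have "binomial_tail (Suc n) j x \<le> y * binomial_tail n i x + (1 - y) * binomial_tail n (Suc i) x"
      by (simp add: Suc binomial_tail_Suc_Suc algebra_simps)
    also have "\<dots> \<le> binomial_tail (Suc n) j y"
      unfolding Suc binomial_tail_Suc_Suc
      using assms Suc.IH by (intro add_mono mult_left_mono) auto
    finally show ?thesis .
  qed simp
qed

lemma binomial_tail_1: "binomial_tail n (Suc 0) z = 1 - (1 - z) ^ n"
proof (induction n)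
  case (Suc n)
  have "binomial_tail (Suc n) (Suc 0) z = z * 1 + (1 - z) * (1 - (1 - z) ^ n)"
    by (simp add: binomial_tail_Suc_Suc Suc.IH)
  then show ?case by (simp add: algebra_simps)
qed simp

lemma binomial_tail_less_1:
  assumes "0 \<le> z" "z < 1" "0 < j"
  shows "binomial_tail n j z < 1"
proof -
  have "binomial_tail n j z \<le> binomial_tail n (Suc 0) z"
    using assms by (intro binomial_tail_antimono) auto
  also have "\<dots> < 1" using assms by (simp add: binomial_tail_1)
  finally show ?thesis .
qed

text \<open>
  Markov's inequality for the mean \<open>n z\<close>.
\<close>
lemma binomial_tail_Markov:
  assumes "0 \<le> z" "z \<le> 1"
  shows "real j * binomial_tail n j z \<le> real n * z"
proof (induction n arbitrary: j)
  case 0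
  show ?case by (cases j) auto
next
  case (Suc n)
  show ?case
  proof (cases j)
    case (Suc i)
    have "real j * binomial_tail (Suc n) j z
        = z * (real i * binomial_tail n i z) + z * binomial_tail n i z
          + (1 - z) * (real (Suc i) * binomial_tail n (Suc i) z)"
      by (simp add: Suc binomial_tail_Suc_Suc algebra_simps)
    also have "\<dots> \<le> z * (real n * z) + z * 1 + (1 - z) * (real n * z)"
      using assms Suc.IH[of i] Suc.IH[of "Suc i"] binomial_tail_le_1[OF assms]
      by (intro add_mono mult_left_mono) simp_all
    also have "\<dots> = real (Suc n) * z" by (simp add: algebra_simps)
    finally show ?thesis .
  qed (use assms in simp)
qed

lemma binomial_tail_Hoeffding:
  assumes z: "0 \<le> z" "z \<le> 1" and n: "0 < n" and eps: "0 \<le> \<epsilon>" "real j \<le> real n * (z - \<epsilon>)"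
  shows "1 - exp (- 2 * real n * \<epsilon>\<^sup>2) \<le> binomial_tail n j z"
proof (cases j)
  case (Suc i)
  interpret binomial_distribution n z by unfold_locales (use z in auto)
  have "measure_pmf.prob (binomial_pmf n z) {i'. i' \<le> i}
      \<le> measure_pmf.prob (binomial_pmf n z) {x. real x \<le> real n * z - real n * \<epsilon>}"
    using eps(2) Suc by (intro measure_pmf.finite_measure_mono) (auto simp: algebra_simps)
  also have "\<dots> \<le> exp (-2 * (real n * \<epsilon>)\<^sup>2 / real n)"
    by (rule prob_le) (use n eps in auto)
  also have "\<dots> = exp (- 2 * real n * \<epsilon>\<^sup>2)"
    using n by (simp add: power2_eq_square)
  finally show ?thesis using prob_binomial_le_eq[OF z, of n i] Suc by simp
qed (simp)

section \<open>Counting independent events\<close>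

lemma sum_subsets_by_card:
  fixes g :: "nat \<Rightarrow> real"
  assumes C: "finite C"
  shows "(\<Sum>S\<in>{S. S \<subseteq> C \<and> j \<le> card S}. g (card S)) = (\<Sum>i=j..card C. real (card C choose i) * g i)"
proof -
  have fin: "finite {S. S \<subseteq> C \<and> j \<le> card S}"
    using C by simp
  have img: "card ` {S. S \<subseteq> C \<and> j \<le> card S} \<subseteq> {j..card C}"
    using C by (auto intro: card_mono)
  have "(\<Sum>S\<in>{S. S \<subseteq> C \<and> j \<le> card S}. g (card S))
      = (\<Sum>i=j..card C. \<Sum>S\<in>{S\<in>{S. S \<subseteq> C \<and> j \<le> card S}. card S = i}. g (card S))"
    by (rule sum.group[symmetric, OF fin _ img]) simp
  also have "\<dots> = (\<Sum>i=j..card C. real (card C choose i) * g i)"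
  proof (rule sum.cong[OF refl])
    fix i assume i: "i \<in> {j..card C}"
    then have "{S\<in>{S. S \<subseteq> C \<and> j \<le> card S}. card S = i} = {S. S \<subseteq> C \<and> card S = i}"
      by auto
    then show "(\<Sum>S\<in>{S\<in>{S. S \<subseteq> C \<and> j \<le> card S}. card S = i}. g (card S)) = real (card C choose i) * g i"
      using n_subsets[OF C, of i] by simp
  qed
  finally show ?thesis .
qed

text \<open>
  The number of independent events of equal probability that occur is binomial, and it is independent
  of one further event \<open>X a\<close>. The event is split according to the exact set of indices that occur.
\<close>
lemma (in prob_space) prob_card_indep_events_ge:
  fixes X :: "'i \<Rightarrow> 'a \<Rightarrow> bool"
  assumes ind: "indep_vars (\<lambda>_. count_space UNIV) X (insert a C)"
    and C: "finite C" "a \<notin> C"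
    and e: "\<And>w. w \<in> C \<Longrightarrow> prob {\<omega>\<in>space M. X w \<omega>} = e"
  shows "prob {\<omega>\<in>space M. X a \<omega> \<and> j \<le> card {w\<in>C. X w \<omega>}}
       = prob {\<omega>\<in>space M. X a \<omega>} * binomial_tail (card C) j e"
proof -
  have meas [measurable]: "Measurable.pred M (X i)" if "i \<in> insert a C" for i
    using ind that by (auto simp: indep_vars_def)
  \<comment> \<open>the event that \<open>a\<close> and exactly the indices in \<open>S\<close> occur\<close>
  define pat where "pat S = (\<Inter>i\<in>insert a C. X i -` {i = a \<or> i \<in> S} \<inter> space M)" for S
  have pat_iff: "\<omega> \<in> pat S \<longleftrightarrow> \<omega> \<in> space M \<and> X a \<omega> \<and> {w\<in>C. X w \<omega>} = S" if "S \<subseteq> C" for \<omega> S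
    using that C by (auto simp: pat_def)
  have pat_sets: "pat S \<in> events" for S
    unfolding pat_def
  proof (intro sets.finite_INT)
    fix i assume i: "i \<in> insert a C"
    show "X i -` {i = a \<or> i \<in> S} \<inter> space M \<in> events"
      by (rule measurable_sets[OF meas[OF i]]) simp
  qed (use C in auto)
  have pat_prob: "prob (pat S) = prob {\<omega>\<in>space M. X a \<omega>} * (e ^ card S * (1 - e) ^ (card C - card S))"
    if S: "S \<subseteq> C" for S
  proof -
    have q: "prob (X i -` {i = a \<or> i \<in> S} \<inter> space M) = (if i \<in> S then e else 1 - e)" if i: "i \<in> C" for i
    proof (cases "i \<in> S")
      case True
      then have "X i -` {i = a \<or> i \<in> S} \<inter> space M = {\<omega>\<in>space M. X i \<omega>}" by auto
      then show ?thesis using True e[OF i] by simp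
    next
      case False
      then have "X i -` {i = a \<or> i \<in> S} \<inter> space M = space M - {\<omega>\<in>space M. X i \<omega>}"
        using i C by auto
      moreover have "{\<omega>\<in>space M. X i \<omega>} \<in> events"
        using meas[of i] i by simp
      ultimately show ?thesis using False e[OF i] by (simp add: prob_compl)
    qed
    have a: "X a -` {True} \<inter> space M = {\<omega>\<in>space M. X a \<omega>}" by auto
    have "prob (pat S) = (\<Prod>i\<in>insert a C. prob (X i -` {i = a \<or> i \<in> S} \<inter> space M))"
      unfolding pat_def by (rule indep_varsD_finite[OF ind]) (use C in auto)
    also have "\<dots> = prob {\<omega>\<in>space M. X a \<omega>} * (\<Prod>i\<in>C. if i \<in> S then e else 1 - e)"
      using C q by (simp add: a)
    also have "(\<Prod>i\<in>C. if i \<in> S then e else 1 - e) = e ^ card S * (1 - e) ^ card (C - S)"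
      using C S by (simp add: prod.If_cases Int_absorb1 Diff_eq)
    also have "card (C - S) = card C - card S"
      using C S by (meson card_Diff_subset finite_subset)
    finally show ?thesis .
  qed
  let ?I = "{S. S \<subseteq> C \<and> j \<le> card S}"
  have "{\<omega>\<in>space M. X a \<omega> \<and> j \<le> card {w\<in>C. X w \<omega>}} = (\<Union>S\<in>?I. pat S)"
    using pat_iff by auto
  also have "prob \<dots> = (\<Sum>S\<in>?I. prob (pat S))"
  proof (rule finite_measure_finite_Union)
    show "finite ?I" using C by simp
    show "pat ` ?I \<subseteq> events" using pat_sets by auto
    show "disjoint_family_on pat ?I"
      unfolding disjoint_family_on_def
    proof (intro ballI impI)
      fix S S' assume S: "S \<in> ?I" "S' \<in> ?I" "S \<noteq> S'"
      have "\<omega> \<notin> pat S'" if "\<omega> \<in> pat S" for \<omega>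
        using that S pat_iff[of S \<omega>] pat_iff[of S' \<omega>] by simp
      then show "pat S \<inter> pat S' = {}" by blast
    qed
  qed
  also have "\<dots> = (\<Sum>S\<in>?I. prob {\<omega>\<in>space M. X a \<omega>} * (e ^ card S * (1 - e) ^ (card C - card S)))"
    using pat_prob by (intro sum.cong) auto
  also have "\<dots> = prob {\<omega>\<in>space M. X a \<omega>} * binomial_tail (card C) j e"
    by (subst sum_distrib_left[symmetric], subst sum_subsets_by_card[OF C(1)])
       (simp add: binomial_tail_def mult.assoc)
  finally show ?thesis .
qed

text \<open>
  Written as a finite disjunction over the subsets of \<open>C\<close> with at least \<open>j\<close> elements, each of which is
  a finite conjunction.
\<close>
lemma pred_card_ge:
  assumes C: "finite C" and E: "\<And>w. w \<in> C \<Longrightarrow> Measurable.pred M (E w)"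
  shows "Measurable.pred M (\<lambda>\<omega>. j \<le> card {w\<in>C. E w \<omega>})"
proof -
  have "(j \<le> card {w\<in>C. E w \<omega>}) \<longleftrightarrow> (\<exists>S\<in>{S\<in>Pow C. j \<le> card S}. \<forall>w\<in>S. E w \<omega>)" for \<omega>
  proof
    assume "\<exists>S\<in>{S\<in>Pow C. j \<le> card S}. \<forall>w\<in>S. E w \<omega>"
    then obtain S where S: "S \<subseteq> {w\<in>C. E w \<omega>}" "j \<le> card S" by auto
    then show "j \<le> card {w\<in>C. E w \<omega>}" using card_mono[OF _ S(1)] C by auto
  qed (rule bexI[of _ "{w\<in>C. E w \<omega>}"], auto)
  moreover have "Measurable.pred M (\<lambda>\<omega>. \<exists>S\<in>{S\<in>Pow C. j \<le> card S}. \<forall>w\<in>S. E w \<omega>)"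
    using C E finite_subset[OF _ C] by (intro pred_intros_finite) auto
  ultimately show ?thesis by simp
qed

section \<open>Branches of a regular tree\<close>

text \<open>
  The vertices on the side of \<open>v\<close> when the edge from \<open>u\<close> to \<open>v\<close> is cut. Forbidding the vertex \<open>u\<close>
  instead of the edge lets the definition make sense without assuming that \<open>u\<close> and \<open>v\<close> are adjacent.
\<close>
definition branch :: "'v ugraph \<Rightarrow> 'v \<Rightarrow> 'v \<Rightarrow> 'v set" where
  "branch G u v = {x. (\<lambda>a b. adjacent G a b \<and> a \<noteq> u \<and> b \<noteq> u)\<^sup>*\<^sup>* v x}"

lemma adjacent_commute: "adjacent G a b \<longleftrightarrow> adjacent G b a"
  by (simp add: adjacent_def insert_commute)

lemma distinct_path_of_rtranclp:
  assumes "R\<^sup>*\<^sup>* x y"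
  shows "\<exists>xs. xs \<noteq> [] \<and> hd xs = x \<and> last xs = y \<and> distinct xs \<and> successively R xs"
  using assms
proof (induction rule: converse_rtranclp_induct)
  case base
  show ?case by (rule exI[of _ "[y]"]) simp
next
  case (step x z)
  then obtain xs where xs: "xs \<noteq> []" "hd xs = z" "last xs = y" "distinct xs" "successively R xs"
    by blast
  show ?case
  proof (cases "x \<in> set xs")
    case True
    then obtain as bs where "xs = as @ x # bs" by (auto dest: split_list)
    then show ?thesis using xs
      by (intro exI[of _ "x # bs"]) (auto simp: successively_append_iff)
  next
    case False
    then show ?thesis using xs step.hyps(1)
      by (intro exI[of _ "x # xs"]) (auto simp: successively_Cons)
  qed
qed

text \<open>
  A path between two different neighbors of \<open>v\<close> that avoids \<open>v\<close> closes up to a cycle through \<open>v\<close>.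
  This is the only place where acyclicity is used.
\<close>
lemma unique_neighbor_per_branch:
  assumes acyclic: "\<nexists>c. is_cycle G c"
    and w: "adjacent G v w1" "adjacent G v w2" "v \<noteq> w1"
    and path: "(\<lambda>a b. adjacent G a b \<and> a \<noteq> v \<and> b \<noteq> v)\<^sup>*\<^sup>* w1 w2"
  shows "w1 = w2"
proof (rule ccontr)
  assume ne: "w1 \<noteq> w2"
  let ?R = "\<lambda>a b. adjacent G a b \<and> a \<noteq> v \<and> b \<noteq> v"
  obtain xs where xs: "xs \<noteq> []" "hd xs = w1" "last xs = w2" "distinct xs" "successively ?R xs"
    using distinct_path_of_rtranclp[OF path] by blast
  from xs(1,2,3) ne obtain ys where ys: "xs = w1 # ys" "ys \<noteq> []"
    by (cases xs) (auto split: if_splits)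
  have avoid: "v \<notin> set zs" if "successively ?R zs" "v \<noteq> hd zs" for zs
    using that
  proof (induction zs)
    case (Cons z zs)
    then show ?case by (cases zs) auto
  qed simp
  have "v \<notin> set xs"
    using avoid[OF xs(5)] xs(2) w(3) by simp
  moreover have "successively (adjacent G) xs"
    using xs(5) by (rule successively_mono) auto
  ultimately have "is_cycle G (v # xs)"
    using xs ys w by (auto simp: is_cycle_def successively_Cons adjacent_commute Suc_le_eq)
  then show False using acyclic by blast
qed

locale regular_tree =
  fixes G :: "'v ugraph" and d :: nat
  assumes tree: "tree G" and reg: "regular (d + 1) G"
begin

abbreviation "V \<equiv> verts G"
abbreviation "N \<equiv> neighbors G"

lemma adjacent_verts: "adjacent G a b \<Longrightarrow> a \<in> V \<and> b \<in> V \<and> a \<noteq> b"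
  using tree unfolding tree_def simple_graph_def adjacent_def
  by (metis doubleton_eq_iff)

lemma mem_N [simp]: "b \<in> N a \<longleftrightarrow> adjacent G a b"
  by (simp add: neighbors_def)

lemma card_N: "a \<in> V \<Longrightarrow> card (N a) = d + 1"
  using reg by (auto simp: regular_def)

lemma finite_N [simp]: "finite (N a)"
proof (cases "a \<in> V")
  case False
  then have "N a = {}" using adjacent_verts by (auto simp: neighbors_def)
  then show ?thesis by simp
qed (use reg in \<open>auto simp: regular_def\<close>)

lemma finite_adjacent_filter [simp]: "finite {w. adjacent G v w \<and> Q w}"
  using finite_N[of v] by (rule finite_subset[rotated]) auto

abbreviation children :: "'v \<Rightarrow> 'v \<Rightarrow> 'v set" where
  "children u v \<equiv> N v - {u}"

lemma card_children: "adjacent G u v \<Longrightarrow> card (children u v) = d"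
  using card_N[of v] adjacent_verts[of u v] adjacent_commute[of G u v]
  by (auto simp: card_Diff_singleton)

lemma exists_edge: "\<exists>u v. adjacent G u v"
proof -
  obtain r where r: "r \<in> V" using tree by (auto simp: tree_def connected_graph_def)
  then have "N r \<noteq> {}" using card_N[OF r] by auto
  then show ?thesis by auto
qed

lemma exists_neighbor: "v \<in> V \<Longrightarrow> \<exists>u. adjacent G u v"
  using card_N[of v] adjacent_commute[of G] by (cases "N v = {}") auto

lemma countable_verts: "countable V"
proof -
  obtain r where r: "r \<in> V" using tree by (auto simp: tree_def connected_graph_def)
  have fin: "finite {x. (adjacent G ^^ n) r x} \<and> {x. (adjacent G ^^ n) r x} \<subseteq> V" for n
  proof (induction n)
    case (Suc n)
    have "{x. (adjacent G ^^ Suc n) r x} = (\<Union>y\<in>{x. (adjacent G ^^ n) r x}. N y)"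
      by auto
    then show ?case using Suc adjacent_verts by (auto simp del: relpowp.simps)
  qed (use r in auto)
  have "V \<subseteq> (\<Union>n. {x. (adjacent G ^^ n) r x})"
    using tree r by (auto simp: tree_def connected_graph_def rtranclp_power)
  moreover have "countable (\<Union>n. {x. (adjacent G ^^ n) r x})"
    using fin by (intro countable_UN) (auto intro: countable_finite)
  ultimately show ?thesis by (rule countable_subset)
qed

lemma self_mem_branch: "v \<in> branch G u v"
  by (simp add: branch_def)

lemma branch_subset_verts: assumes "adjacent G u v" shows "branch G u v \<subseteq> V"
proof
  fix x assume "x \<in> branch G u v"
  then have "(\<lambda>a b. adjacent G a b \<and> a \<noteq> u \<and> b \<noteq> u)\<^sup>*\<^sup>* v x" by (simp add: branch_def)
  then show "x \<in> V"
    by (induction rule: rtranclp_induct) (use adjacent_verts assms in blast)+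
qed

lemma not_mem_branch: assumes "adjacent G u v" shows "u \<notin> branch G u v"
proof
  assume "u \<in> branch G u v"
  then have "(\<lambda>a b. adjacent G a b \<and> a \<noteq> u \<and> b \<noteq> u)\<^sup>*\<^sup>* v u" by (simp add: branch_def)
  then show False using adjacent_verts[OF assms] by (cases rule: rtranclp.cases) auto
qed

lemma disjoint_branches:
  assumes "adjacent G v w1" "adjacent G v w2" "w1 \<noteq> w2"
  shows "branch G v w1 \<inter> branch G v w2 = {}"
proof (rule ccontr)
  let ?R = "\<lambda>a b. adjacent G a b \<and> a \<noteq> v \<and> b \<noteq> v"
  assume "branch G v w1 \<inter> branch G v w2 \<noteq> {}"
  then obtain x where x: "?R\<^sup>*\<^sup>* w1 x" "?R\<^sup>*\<^sup>* w2 x" by (auto simp: branch_def)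
  have "symp ?R" by (auto simp: symp_def adjacent_commute)
  then have "?R\<^sup>*\<^sup>* x w2" using x(2) by (meson symp_rtranclp sympE)
  then have "?R\<^sup>*\<^sup>* w1 w2" using x(1) by auto
  then show False
    using unique_neighbor_per_branch[of G v w1 w2] tree assms adjacent_verts[OF assms(1)]
    by (auto simp: tree_def)
qed

text \<open>
  A walk from \<open>w\<close> that avoids \<open>v\<close> also avoids \<open>u\<close>, since \<open>u\<close> and \<open>w\<close> lie in different branches at \<open>v\<close>.
\<close>
lemma child_branch_subset:
  assumes uv: "adjacent G u v" and w: "w \<in> children u v"
  shows "branch G v w \<subseteq> branch G u v"
proof
  have vw: "adjacent G v w" and wu: "w \<noteq> u" using w by auto
  have u: "u \<notin> branch G v w"
    using disjoint_branches[OF vw _ wu] uv self_mem_branch adjacent_commute by fastforce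
  fix x assume "x \<in> branch G v w"
  then have "(\<lambda>a b. adjacent G a b \<and> a \<noteq> v \<and> b \<noteq> v)\<^sup>*\<^sup>* w x" by (simp add: branch_def)
  then have "x \<in> branch G u v \<and> x \<in> branch G v w"
  proof (induction rule: rtranclp_induct)
    case base
    have "(\<lambda>a b. adjacent G a b \<and> a \<noteq> u \<and> b \<noteq> u) v w"
      using vw wu adjacent_verts[OF uv] by auto
    then show ?case using self_mem_branch by (auto simp: branch_def)
  next
    case (step y z)
    then have "z \<in> branch G v w"
      unfolding branch_def by (auto intro: rtranclp.rtrancl_into_rtrancl)
    moreover from this have "z \<noteq> u" "y \<noteq> u" using u step.IH by auto
    ultimately show ?case using step
      unfolding branch_def by (auto intro: rtranclp.rtrancl_into_rtrancl)
  qed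
  then show "x \<in> branch G u v" ..
qed

end

section \<open>Percolation on branches\<close>

text \<open>
  The process in the branch of \<open>v\<close> behind \<open>u\<close>, where \<open>u\<close> counts as vacant for ever: \<open>vacant_within G m n u v \<omega>\<close>
  says that \<open>v\<close> is vacant there at time \<open>n - 1\<close>. The shift by one lets the recursion start from the
  trivial event.
\<close>
primrec vacant_within :: "'v ugraph \<Rightarrow> nat \<Rightarrow> nat \<Rightarrow> 'v \<Rightarrow> 'v \<Rightarrow> ('v \<Rightarrow> bool) \<Rightarrow> bool" where
  "vacant_within G m 0 u v \<omega> = True"
| "vacant_within G m (Suc n) u v \<omega> =
     (\<not> \<omega> v \<and> m \<le> card {w \<in> neighbors G v - {u}. vacant_within G m n v w \<omega>})"

text \<open>
  The branches at depth \<open>n\<close> below \<open>v\<close> are reached by recursion and not enumerated, so that the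
  probability can be computed one level at a time.
\<close>
primrec defect_within ::
  "('v \<Rightarrow> 'v \<Rightarrow> ('v \<Rightarrow> bool) \<Rightarrow> bool) \<Rightarrow> 'v ugraph \<Rightarrow> nat \<Rightarrow> 'v \<Rightarrow> 'v \<Rightarrow> ('v \<Rightarrow> bool) \<Rightarrow> bool" where
  "defect_within Z G 0 u v \<omega> = Z u v \<omega>"
| "defect_within Z G (Suc n) u v \<omega> = (\<exists>w \<in> neighbors G v - {u}. defect_within Z G n v w \<omega>)"

locale regular_tree_percolation = regular_tree G d for G :: "'v ugraph" and d :: nat +
  fixes k :: nat and p :: real
  assumes k: "2 \<le> k" "k \<le> d" and p: "0 \<le> p" "p \<le> 1"
begin

abbreviation "m \<equiv> d - k + 1"
abbreviation "law \<equiv> initial_law G p"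
abbreviation "site \<equiv> measure_pmf (bernoulli_pmf p)"

sublocale prob_space law
  unfolding initial_law_def by (intro prob_space_PiM measure_pmf.prob_space_axioms)

lemma space_law_restrict: "\<omega> \<in> space law \<Longrightarrow> restrict \<omega> V = \<omega>"
  by (auto simp: initial_law_def space_PiM)

lemma measurable_site: "v \<in> V \<Longrightarrow> (\<lambda>\<omega>. \<omega> v) \<in> measurable law site"
  unfolding initial_law_def by (rule measurable_component_singleton)

lemma indep_sites: "indep_vars (\<lambda>_. site) (\<lambda>v \<omega>. \<omega> v) V"
proof -
  have "V \<noteq> {}" using exists_edge adjacent_verts by blast
  moreover have "distr law (\<Pi>\<^sub>M i\<in>V. site) (\<lambda>\<omega>. \<lambda>i\<in>V. \<omega> i) = distr law law (\<lambda>\<omega>. \<omega>)"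
    using space_law_restrict by (intro distr_cong) (auto simp: initial_law_def)
  moreover have "(\<Pi>\<^sub>M i\<in>V. distr law site (\<lambda>\<omega>. \<omega> i)) = (\<Pi>\<^sub>M i\<in>V. site)"
    unfolding initial_law_def
    by (intro PiM_cong refl distr_PiM_component measure_pmf.prob_space_axioms)
  ultimately show ?thesis
    by (subst indep_vars_iff_distr_eq_PiM') (simp_all add: measurable_site initial_law_def distr_id2)
qed

lemma prob_site: "v \<in> V \<Longrightarrow> prob {\<omega>\<in>space law. R (\<omega> v)} = measure_pmf.prob (bernoulli_pmf p) {b. R b}"
proof -
  assume v: "v \<in> V"
  have "distr law site (\<lambda>\<omega>. \<omega> v) = site"
    unfolding initial_law_def using v
    by (intro distr_PiM_component measure_pmf.prob_space_axioms)
  then have "measure site {b. R b} = prob ((\<lambda>\<omega>. \<omega> v) -` {b. R b} \<inter> space law)"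
    using measure_distr[OF measurable_site[OF v], of "{b. R b}"] by simp
  also have "(\<lambda>\<omega>. \<omega> v) -` {b. R b} \<inter> space law = {\<omega>\<in>space law. R (\<omega> v)}" by auto
  finally show ?thesis by simp
qed

text \<open>
  A measurable event that depends only on the sites in \<open>B\<close>, as a predicate on all configurations. Such
  predicates for disjoint sets \<open>B\<close> are independent, and no restriction maps appear in their statements.
\<close>
definition determined_on :: "'v set \<Rightarrow> (('v \<Rightarrow> bool) \<Rightarrow> bool) \<Rightarrow> bool" where
  "determined_on B E \<longleftrightarrow>
     Measurable.pred (\<Pi>\<^sub>M i\<in>B. site) E \<and> (\<forall>\<omega>. E (restrict \<omega> B) = E \<omega>)"

lemma determined_on_mono:
  assumes "determined_on B E" "B \<subseteq> B'"
  shows "determined_on B' E"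
proof -
  have "Measurable.pred (\<Pi>\<^sub>M i\<in>B'. site) (\<lambda>\<omega>. E (restrict \<omega> B))"
    using assms by (intro measurable_compose[OF measurable_restrict_subset])
      (auto simp: determined_on_def)
  moreover have "E (restrict \<omega> B') = E \<omega>" for \<omega>
    using assms by (metis determined_on_def Int_absorb1 restrict_restrict)
  ultimately show ?thesis using assms by (simp add: determined_on_def)
qed

lemma determined_on_site: "determined_on {v} (\<lambda>\<omega>. R (\<omega> v))"
  by (auto simp: determined_on_def intro!: measurable_compose[OF measurable_component_singleton[of v]])

lemma pred_law: "determined_on B E \<Longrightarrow> B \<subseteq> V \<Longrightarrow> Measurable.pred law E"
  using determined_on_mono[of B E V] by (simp add: determined_on_def initial_law_def)

text \<open>
  A family of events, one for each branch, that only look at their branch and all have probability \<open>e\<close>.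
  Equal probabilities express the homogeneity of the tree without automorphisms.
\<close>
definition branch_events :: "('v \<Rightarrow> 'v \<Rightarrow> ('v \<Rightarrow> bool) \<Rightarrow> bool) \<Rightarrow> real \<Rightarrow> bool" where
  "branch_events E e \<longleftrightarrow>
     (\<forall>u v. adjacent G u v \<longrightarrow>
        determined_on (branch G u v) (E u v) \<and> prob {\<omega>\<in>space law. E u v \<omega>} = e)"

lemma branch_events_pred:
  "branch_events E e \<Longrightarrow> adjacent G u v \<Longrightarrow> Measurable.pred law (E u v)"
  using pred_law[of "branch G u v" "E u v"] branch_subset_verts[of u v]
  by (simp add: branch_events_def)

text \<open>
  One step of the recursion over the tree: the branches behind the children of \<open>v\<close> and the site \<open>v\<close>
  itself are disjoint, so the condition on \<open>v\<close> and the \<open>d\<close> events at the children are independent.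
\<close>
lemma branch_events_step:
  assumes E: "branch_events E e"
  shows "branch_events (\<lambda>u v \<omega>. R (\<omega> v) \<and> j \<le> card {w \<in> children u v. E v w \<omega>})
           (measure_pmf.prob (bernoulli_pmf p) {b. R b} * binomial_tail d j e)"
  unfolding branch_events_def
proof (intro allI impI conjI)
  fix u v assume uv: "adjacent G u v"
  then have v: "v \<in> V" using adjacent_verts by auto
  let ?C = "children u v"
  have vC: "v \<notin> ?C" using adjacent_verts[of v v] by auto
  have Edet: "determined_on (branch G v w) (E v w)" "prob {\<omega>\<in>space law. E v w \<omega>} = e"
    if "w \<in> ?C" for w
    using E that by (auto simp: branch_events_def)
  have Edet': "determined_on (branch G u v) (E v w)" if "w \<in> ?C" for w
    using Edet(1)[OF that] child_branch_subset[OF uv that] by (rule determined_on_mono)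
  have Rdet: "determined_on (branch G u v) (\<lambda>\<omega>. R (\<omega> v))"
    using determined_on_site by (rule determined_on_mono) (simp add: self_mem_branch)
  show "determined_on (branch G u v) (\<lambda>\<omega>. R (\<omega> v) \<and> j \<le> card {w \<in> ?C. E v w \<omega>})"
    unfolding determined_on_def
  proof (intro conjI allI)
    show "Measurable.pred (\<Pi>\<^sub>M i\<in>branch G u v. site) (\<lambda>\<omega>. R (\<omega> v) \<and> j \<le> card {w \<in> ?C. E v w \<omega>})"
      using Rdet Edet'
      by (intro pred_intros_logic pred_card_ge) (auto simp: determined_on_def)
    fix \<omega>
    have "E v w (restrict \<omega> (branch G u v)) = E v w \<omega>" if "w \<in> ?C" for w
      using Edet'[OF that] by (simp add: determined_on_def)
    then have "{w \<in> ?C. E v w (restrict \<omega> (branch G u v))} = {w \<in> ?C. E v w \<omega>}" by blast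
    then show "(R (restrict \<omega> (branch G u v) v) \<and> j \<le> card {w \<in> ?C. E v w (restrict \<omega> (branch G u v))})
             = (R (\<omega> v) \<and> j \<le> card {w \<in> ?C. E v w \<omega>})"
      using self_mem_branch[of v u] by simp
  qed
  \<comment> \<open>\<open>K\<close> and \<open>X\<close> bundle the site \<open>v\<close> with its children, indexed by \<open>insert v ?C\<close>\<close>
  define K where "K i = (if i = v then {v} else branch G v i)" for i
  define X where "X i \<omega> = (if i = v then R (\<omega> v) else E v i \<omega>)" for i \<omega>
  have Xdet: "determined_on (K i) (X i)" if "i \<in> insert v ?C" for i
    using that Edet(1) determined_on_site vC by (auto simp: K_def X_def[abs_def])
  have Xe: "prob {\<omega>\<in>space law. X w \<omega>} = e" if w: "w \<in> ?C" for w
  proof -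
    have "w \<noteq> v" using w vC by blast
    then show ?thesis using Edet(2)[OF w] by (simp add: X_def)
  qed
  have "indep_vars (\<lambda>i. \<Pi>\<^sub>M i\<in>K i. site) (\<lambda>i \<omega>. restrict (\<lambda>j. \<omega> j) (K i)) (insert v ?C)"
  proof (rule indep_vars_restrict[OF indep_sites])
    show "K i \<subseteq> V" if "i \<in> insert v ?C" for i
      using that branch_subset_verts[of v i] v by (auto simp: K_def)
    show "disjoint_family_on K (insert v ?C)"
      using disjoint_branches[of v] not_mem_branch[of v]
      by (auto simp: disjoint_family_on_def K_def)
  qed
  then have "indep_vars (\<lambda>_. count_space UNIV) (\<lambda>i \<omega>. X i (restrict (\<lambda>j. \<omega> j) (K i))) (insert v ?C)"
    by (rule indep_vars_compose2) (use Xdet in \<open>auto simp: determined_on_def\<close>)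
  then have "indep_vars (\<lambda>_. count_space UNIV) X (insert v ?C)"
    by (rule indep_vars_cong[THEN iffD1, rotated -1])
       (use Xdet in \<open>auto simp: determined_on_def\<close>)
  then have "prob {\<omega>\<in>space law. X v \<omega> \<and> j \<le> card {w\<in>?C. X w \<omega>}}
      = prob {\<omega>\<in>space law. X v \<omega>} * binomial_tail (card ?C) j e"
    by (rule prob_card_indep_events_ge)
       (use vC Xe in simp_all)
  moreover have "{w\<in>?C. X w \<omega>} = {w\<in>?C. E v w \<omega>}" for \<omega>
    using vC by (auto simp: X_def)
  ultimately show "prob {\<omega>\<in>space law. R (\<omega> v) \<and> j \<le> card {w \<in> ?C. E v w \<omega>}}
      = measure_pmf.prob (bernoulli_pmf p) {b. R b} * binomial_tail d j e"
    using card_children[OF uv] prob_site[OF v] by (simp add: X_def)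
qed

text \<open>
  Continuity from above of the probability measure, in each branch.
\<close>
lemma branch_events_decreasing_limit:
  assumes E: "\<And>n. branch_events (E n) (e n)"
    and dec: "\<And>n u v \<omega>. E (Suc n) u v \<omega> \<Longrightarrow> E n u v \<omega>"
    and lim: "e \<longlonglongrightarrow> q"
  shows "branch_events (\<lambda>u v \<omega>. \<forall>n. E n u v \<omega>) q"
  unfolding branch_events_def
proof (intro allI impI conjI)
  fix u v assume uv: "adjacent G u v"
  have det: "determined_on (branch G u v) (E n u v)" for n
    using E uv by (auto simp: branch_events_def)
  then show "determined_on (branch G u v) (\<lambda>\<omega>. \<forall>n. E n u v \<omega>)"
    unfolding determined_on_def by (intro conjI pred_intros_countable) simp_all
  let ?A = "\<lambda>n. {\<omega>\<in>space law. E n u v \<omega>}"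
  have "(\<lambda>n. prob (?A n)) \<longlonglongrightarrow> prob (\<Inter>n. ?A n)"
  proof (rule finite_Lim_measure_decseq)
    show "range ?A \<subseteq> events"
      using branch_events_pred[OF E uv] by (auto simp: pred_def)
    show "decseq ?A" by (rule decseq_SucI) (simp add: Collect_mono_iff dec)
  qed
  moreover have "prob (?A n) = e n" for n using E uv by (auto simp: branch_events_def)
  moreover have "(\<Inter>n. ?A n) = {\<omega>\<in>space law. \<forall>n. E n u v \<omega>}" by auto
  ultimately show "prob {\<omega>\<in>space law. \<forall>n. E n u v \<omega>} = q"
    using lim LIMSEQ_unique by auto
qed

definition vacant_prob :: "nat \<Rightarrow> real" where
  "vacant_prob n = ((\<lambda>q. (1 - p) * binomial_tail d m q) ^^ n) 1"

lemma vacant_prob_simps [simp]: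
  "vacant_prob 0 = 1" "vacant_prob (Suc n) = (1 - p) * binomial_tail d m (vacant_prob n)"
  by (simp_all add: vacant_prob_def)

lemma prob_bernoulli_vacant: "measure_pmf.prob (bernoulli_pmf p) {b. \<not> b} = 1 - p"
proof -
  have "{b. \<not> b} = {False}" by auto
  then show ?thesis using p by (simp add: measure_pmf_single)
qed

lemma branch_events_vacant_within: "branch_events (vacant_within G m n) (vacant_prob n)"
proof (induction n)
  case 0
  show ?case by (auto simp: branch_events_def determined_on_def prob_space)
next
  case (Suc n)
  have "vacant_within G m (Suc n) =
      (\<lambda>u v \<omega>. \<not> \<omega> v \<and> m \<le> card {w \<in> children u v. vacant_within G m n v w \<omega>})"
    by (auto simp: fun_eq_iff)
  then show ?case
    using branch_events_step[OF Suc, of Not m] by (simp add: prob_bernoulli_vacant)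
qed

lemma vacant_within_decreasing:
  "vacant_within G m (Suc n) u v \<omega> \<Longrightarrow> vacant_within G m n u v \<omega>"
proof (induction n arbitrary: u v)
  case (Suc n)
  have "{w \<in> children u v. vacant_within G m (Suc n) v w \<omega>}
      \<subseteq> {w \<in> children u v. vacant_within G m n v w \<omega>}"
    using Suc.IH by blast
  then have "card {w \<in> children u v. vacant_within G m (Suc n) v w \<omega>}
      \<le> card {w \<in> children u v. vacant_within G m n v w \<omega>}"
    by (rule card_mono[rotated]) simp
  then show ?case using Suc.prems unfolding vacant_within.simps(2) by linarith
qed simp


lemma vacant_prob_eq_prob:
  "adjacent G u v \<Longrightarrow> vacant_prob n = prob {\<omega>\<in>space law. vacant_within G m n u v \<omega>}"
  using branch_events_vacant_within by (auto simp: branch_events_def)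

lemma vacant_prob_bounds: "0 \<le> vacant_prob n" "vacant_prob n \<le> 1"
  using exists_edge vacant_prob_eq_prob by fastforce+

text \<open>
  The probabilities decrease because the events do; the limit is a fixed point because \<open>binomial_tail\<close>
  is continuous.
\<close>
lemma vacant_prob_limit:
  obtains q where "vacant_prob \<longlonglongrightarrow> q" "0 \<le> q" "q \<le> 1" "q = (1 - p) * binomial_tail d m q"
proof -
  obtain u v where uv: "adjacent G u v" using exists_edge by blast
  have "vacant_prob (Suc n) \<le> vacant_prob n" for n
    unfolding vacant_prob_eq_prob[OF uv]
    using branch_events_pred[OF branch_events_vacant_within uv, of n] vacant_within_decreasing
    by (intro finite_measure_mono) (auto simp: pred_def simp del: vacant_within.simps)
  then have "decseq vacant_prob" by (rule decseq_SucI)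
  then obtain q where q: "vacant_prob \<longlonglongrightarrow> q"
    using decseq_convergent vacant_prob_bounds(1) by metis
  have "(\<lambda>n. (1 - p) * binomial_tail d m (vacant_prob n)) \<longlonglongrightarrow> (1 - p) * binomial_tail d m q"
    by (intro tendsto_mult tendsto_const isCont_tendsto_compose[OF isCont_binomial_tail q])
  moreover have "(\<lambda>n. vacant_prob (Suc n)) \<longlonglongrightarrow> q"
    using q by (rule LIMSEQ_Suc)
  ultimately have "q = (1 - p) * binomial_tail d m q"
    using LIMSEQ_unique by simp
  moreover have "0 \<le> q" "q \<le> 1"
    using q vacant_prob_bounds by (auto intro: LIMSEQ_le_const LIMSEQ_le_const2)
  ultimately show ?thesis using that q by blast
qed

lemma occupied_initial: "A \<subseteq> occupied G k A n"
  by (induction n) auto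

section \<open>Almost sure complete occupation\<close>

text \<open>
  Regarding \<open>u\<close> as vacant can only delay occupation, so whatever is occupied in the branch process is
  occupied in the full process. Fewer than \<open>m\<close> vacant children leave at least \<open>k\<close> occupied ones.
\<close>
lemma occupied_if_not_vacant_within:
  "adjacent G u v \<Longrightarrow> \<not> vacant_within G m n u v \<omega> \<Longrightarrow> v \<in> occupied G k {x\<in>V. \<omega> x} n"
proof (induction n arbitrary: u v)
  case (Suc n)
  let ?O = "occupied G k {x\<in>V. \<omega> x} n"
  have v: "v \<in> V" using adjacent_verts[OF Suc.prems(1)] by blast
  show ?case
  proof (cases "\<omega> v")
    case True
    then have "v \<in> {x\<in>V. \<omega> x}" using v by simp
    then show ?thesis by (rule subsetD[OF occupied_initial])
  next
    case False
    let ?S = "{w \<in> children u v. vacant_within G m n v w \<omega>}"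
    have "card ?S < m" using Suc.prems(2) False by simp
    then have "k \<le> card (children u v) - card ?S"
      using card_children[OF Suc.prems(1)] k by simp
    also have "\<dots> = card (children u v - ?S)"
      by (rule card_Diff_subset[symmetric]) auto
    also have "\<dots> \<le> card (N v \<inter> ?O)"
    proof (intro card_mono subsetI)
      fix x assume "x \<in> children u v - ?S"
      then show "x \<in> N v \<inter> ?O" using Suc.IH[of v x] by auto
    qed simp
    finally show ?thesis using v by simp
  qed
qed simp

lemma pred_occupied:
  "v \<in> V \<Longrightarrow> Measurable.pred law (\<lambda>\<omega>. v \<in> occupied G k {x\<in>V. \<omega> x} n)"
proof (induction n arbitrary: v)
  case 0
  have "Measurable.pred law (\<lambda>\<omega>. \<omega> v)"
    using measurable_compose[OF measurable_site[OF 0], of id "count_space UNIV"] by simp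
  then show ?case using 0 by simp
next
  case (Suc n)
  have "N v \<inter> occupied G k {x\<in>V. \<omega> x} n = {w\<in>N v. w \<in> occupied G k {x\<in>V. \<omega> x} n}" for \<omega>
    by auto
  moreover have "Measurable.pred law (\<lambda>\<omega>. k \<le> card {w\<in>N v. w \<in> occupied G k {x\<in>V. \<omega> x} n})"
    using Suc.IH adjacent_verts by (intro pred_card_ge) auto
  ultimately show ?case using Suc by simp
qed

lemma never_occupied_events:
  "v \<in> V \<Longrightarrow> {\<omega>\<in>space law. \<forall>n. v \<notin> occupied G k {x\<in>V. \<omega> x} n} \<in> events"
  using pred_occupied[of v] unfolding pred_def[symmetric] by (intro pred_intros_countable pred_intros_logic)

lemma complete_occupation_eq:
  "complete_occupation G k p
     = space law - (\<Union>v\<in>V. {\<omega>\<in>space law. \<forall>n. v \<notin> occupied G k {x\<in>V. \<omega> x} n})"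
  by (auto simp: complete_occupation_def)

lemma complete_occupation_events: "complete_occupation G k p \<in> events"
  unfolding complete_occupation_eq
  using never_occupied_events countable_verts by (intro sets.Diff sets.countable_UN') auto

text \<open>
  Without a root in \<open>(0, 1)\<close> the limit of the vacancy probabilities is \<open>0\<close>; as \<open>p > 0\<close>, the fixed point
  \<open>1\<close> is excluded too. Countably many vertices are then all occupied eventually, almost surely.
\<close>
lemma complete_occupation_almost_surely:
  assumes no_root: "\<And>z. 0 < z \<Longrightarrow> z < 1 \<Longrightarrow> z \<noteq> (1 - p) * binomial_tail d m z" and "0 < p"
  shows "prob (complete_occupation G k p) = 1"
proof -
  obtain q where q: "vacant_prob \<longlonglongrightarrow> q" "0 \<le> q" "q \<le> 1" "q = (1 - p) * binomial_tail d m q"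
    by (rule vacant_prob_limit)
  have "q \<le> (1 - p) * 1"
    by (subst q(4), rule mult_left_mono) (use p q(2,3) binomial_tail_le_1 in auto)
  then have "q < 1" using \<open>0 < p\<close> by simp
  then have "q = 0" using no_root[of q] q by linarith
  have null: "{\<omega>\<in>space law. \<forall>n. v \<notin> occupied G k {x\<in>V. \<omega> x} n} \<in> null_sets law" (is "?A \<in> _")
    if v: "v \<in> V" for v
  proof -
    obtain u where u: "adjacent G u v" using exists_neighbor[OF v] by blast
    have "prob ?A \<le> vacant_prob n" for n
      unfolding vacant_prob_eq_prob[OF u]
      using occupied_if_not_vacant_within[OF u] branch_events_pred[OF branch_events_vacant_within u]
      by (intro finite_measure_mono) (auto simp: pred_def)
    then have "prob ?A \<le> 0"
      using q(1) \<open>q = 0\<close> by (intro LIMSEQ_le_const) auto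
    then show ?thesis
      using never_occupied_events[OF v] by (simp add: null_sets_def emeasure_eq_measure measure_le_0_iff)
  qed
  have "(\<Union>v\<in>V. {\<omega>\<in>space law. \<forall>n. v \<notin> occupied G k {x\<in>V. \<omega> x} n}) \<in> null_sets law"
    using null countable_verts by (intro null_sets_UN') auto
  then show ?thesis
    unfolding complete_occupation_eq by (subst prob_compl) (auto simp: null_sets_def measure_def)
qed

section \<open>Permanently vacant sets\<close>

abbreviation always_vacant :: "'v \<Rightarrow> 'v \<Rightarrow> ('v \<Rightarrow> bool) \<Rightarrow> bool" where
  "always_vacant u v \<omega> \<equiv> \<forall>n. vacant_within G m n u v \<omega>"

text \<open>
  From left to right: for each time there are \<open>m\<close> children vacant until then. The sets of these children
  decrease inside a finite set, so they become constant and the same \<open>m\<close> children are vacant for ever.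
\<close>
lemma always_vacant_fixpoint:
  "always_vacant u v \<omega> \<longleftrightarrow> \<not> \<omega> v \<and> m \<le> card {w \<in> children u v. always_vacant v w \<omega>}"
proof
  assume vac: "always_vacant u v \<omega>"
  have "\<forall>\<^sub>F n in sequentially. vacant_within G m n v w \<omega> \<longrightarrow> always_vacant v w \<omega>" for w
  proof (cases "always_vacant v w \<omega>")
    case False
    then obtain n where n: "\<not> vacant_within G m n v w \<omega>" by blast
    have "\<not> vacant_within G m n' v w \<omega>" if "n \<le> n'" for n'
      using that
    proof (induction n' rule: dec_induct)
      case (step i)
      then show ?case using vacant_within_decreasing by blast
    qed (fact n)
    then show ?thesis unfolding eventually_sequentially by blast
  qed simp
  then have "\<forall>\<^sub>F n in sequentially. \<forall>w\<in>children u v. vacant_within G m n v w \<omega> \<longrightarrow> always_vacant v w \<omega>"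
    by (intro eventually_ball_finite) auto
  then obtain n where n: "\<forall>w\<in>children u v. vacant_within G m n v w \<omega> \<longrightarrow> always_vacant v w \<omega>"
    using eventually_happens' sequentially_bot by blast
  have "\<not> \<omega> v \<and> m \<le> card {w \<in> children u v. vacant_within G m n v w \<omega>}"
    using vac[rule_format, of "Suc n"] by simp
  moreover have "card {w \<in> children u v. vacant_within G m n v w \<omega>}
      \<le> card {w \<in> children u v. always_vacant v w \<omega>}"
    using n by (intro card_mono) auto
  ultimately show "\<not> \<omega> v \<and> m \<le> card {w \<in> children u v. always_vacant v w \<omega>}" by linarith
next
  assume *: "\<not> \<omega> v \<and> m \<le> card {w \<in> children u v. always_vacant v w \<omega>}"
  show "always_vacant u v \<omega>"
  proof
    fix n show "vacant_within G m n u v \<omega>"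
    proof (cases n)
      case (Suc i)
      have "card {w \<in> children u v. always_vacant v w \<omega>}
          \<le> card {w \<in> children u v. vacant_within G m i v w \<omega>}"
        by (intro card_mono) auto
      then show ?thesis using * unfolding Suc vacant_within.simps by linarith
    qed simp
  qed
qed

text \<open>
  The blocked vertices are initially vacant, and each of them has at least \<open>m + 1\<close> blocked neighbors:
  those that are vacant for ever in their branches.
\<close>
definition blocked :: "'v \<Rightarrow> ('v \<Rightarrow> bool) \<Rightarrow> bool" where
  "blocked a \<omega> \<longleftrightarrow> \<not> \<omega> a \<and> m + 1 \<le> card {c \<in> N a. always_vacant a c \<omega>}"

text \<open>
  Seen from \<open>c\<close>, the vertex \<open>a\<close> loses at most the child \<open>c\<close> and keeps \<open>m\<close> permanently vacant ones, so it
  is permanently vacant in its own branch. Together with the \<open>m\<close> such children of \<open>c\<close> behind \<open>a\<close> this makes \<open>m + 1\<close>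
  neighbors of \<open>c\<close>.
\<close>
lemma blocked_neighbor:
  assumes a: "blocked a \<omega>" and c: "c \<in> N a" "always_vacant a c \<omega>"
  shows "blocked c \<omega>"
proof -
  have "{w \<in> children c a. always_vacant a w \<omega>} = {w \<in> N a. always_vacant a w \<omega>} - {c}" by auto
  also have "card \<dots> = card {w \<in> N a. always_vacant a w \<omega>} - 1"
    using c by (intro card_Diff_singleton) simp
  finally have "m \<le> card {w \<in> children c a. always_vacant a w \<omega>}"
    using a unfolding blocked_def by linarith
  then have ca: "always_vacant c a \<omega>"
    using a by (subst always_vacant_fixpoint) (simp add: blocked_def)
  have ac: "\<not> \<omega> c" "m \<le> card {w \<in> children a c. always_vacant c w \<omega>}"
    using c(2) always_vacant_fixpoint[of a c \<omega>] by (simp_all only: simp_thms)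
  have "card (insert a {w \<in> children a c. always_vacant c w \<omega>}) \<le> card {w \<in> N c. always_vacant c w \<omega>}"
    using ca c(1) adjacent_commute[of G a c] by (intro card_mono) auto
  then have "m + 1 \<le> card {w \<in> N c. always_vacant c w \<omega>}"
    using ac(2) by (subst (asm) card_insert_disjoint) auto
  then show ?thesis using ac(1) by (simp add: blocked_def)
qed

text \<open>
  At least \<open>m + 1\<close> of the \<open>d + 1\<close> neighbors are blocked themselves, hence vacant by induction; at most
  \<open>d - m = k - 1\<close> can be occupied.
\<close>
lemma blocked_never_occupied:
  "a \<in> V \<Longrightarrow> blocked a \<omega> \<Longrightarrow> a \<notin> occupied G k {x\<in>V. \<omega> x} n"
proof (induction n arbitrary: a)
  case 0
  then show ?case by (simp add: blocked_def)
next
  case (Suc n)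
  let ?O = "occupied G k {x\<in>V. \<omega> x} n"
  let ?B = "{c \<in> N a. always_vacant a c \<omega>}"
  have "N a \<inter> ?O \<subseteq> N a - ?B"
    using Suc.IH blocked_neighbor[OF Suc.prems(2)] adjacent_verts by auto
  then have "card (N a \<inter> ?O) \<le> card (N a - ?B)"
    by (intro card_mono) auto
  also have "\<dots> = card (N a) - card ?B"
    by (rule card_Diff_subset) auto
  also have "\<dots> < k"
    using Suc.prems(2) k card_N[OF Suc.prems(1)] unfolding blocked_def by linarith
  finally show ?case using Suc by simp
qed

text \<open>
  A condition on the branch of \<open>v\<close> behind \<open>u\<close> alone that forces \<open>v\<close> to be blocked, whatever happens at
  \<open>u\<close>.
\<close>
definition block_root :: "'v \<Rightarrow> 'v \<Rightarrow> ('v \<Rightarrow> bool) \<Rightarrow> bool" where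
  "block_root u v \<omega> \<longleftrightarrow> \<not> \<omega> v \<and> m + 1 \<le> card {w \<in> children u v. always_vacant v w \<omega>}"

lemma block_root_imp_blocked:
  assumes "block_root u v \<omega>"
  shows "blocked v \<omega>"
proof -
  have "card {w \<in> children u v. always_vacant v w \<omega>} \<le> card {w \<in> N v. always_vacant v w \<omega>}"
    by (intro card_mono) auto
  then show ?thesis using assms unfolding blocked_def block_root_def by linarith
qed

lemma defect_imp_not_complete:
  "adjacent G u v \<Longrightarrow> defect_within block_root G n u v \<omega> \<Longrightarrow> \<omega> \<notin> complete_occupation G k p"
proof (induction n arbitrary: u v)
  case 0
  then have "v \<in> V" "blocked v \<omega>" using adjacent_verts block_root_imp_blocked by auto
  then show ?case using blocked_never_occupied by (auto simp: complete_occupation_def)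
qed auto

text \<open>
  The \<open>d ^ n\<close> branches at depth \<open>n\<close> are independent.
\<close>
lemma branch_events_defect_within:
  assumes Z: "branch_events Z c"
  shows "branch_events (defect_within Z G n) (1 - (1 - c) ^ (d ^ n))"
proof (induction n)
  case 0
  have "defect_within Z G 0 = Z" by (simp add: fun_eq_iff)
  then show ?case using Z by simp
next
  case (Suc n)
  have "1 \<le> card {w \<in> children u v. Q w} \<longleftrightarrow> (\<exists>w\<in>children u v. Q w)" for u v Q
    by (auto simp: Suc_le_eq card_gt_0_iff)
  then have "defect_within Z G (Suc n) =
      (\<lambda>u v \<omega>. True \<and> 1 \<le> card {w \<in> children u v. defect_within Z G n v w \<omega>})"
    by (auto simp: fun_eq_iff)
  moreover have "measure_pmf.prob (bernoulli_pmf p) {b. True} = 1"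
    using measure_pmf.prob_space[of "bernoulli_pmf p"] by simp
  ultimately show ?case
    using branch_events_step[OF Suc, of "\<lambda>_. True" 1]
    by (simp add: binomial_tail_1 power_mult[symmetric] mult.commute)
qed

text \<open>
  If \<open>z\<close> lies on or below \<open>(1 - p) * binomial_tail d m z\<close>, then by monotonicity the vacancy probabilities never
  drop below \<open>z\<close>, and permanent vacancy has a positive probability \<open>q\<close>. Then \<open>block_root\<close> has a positive
  probability \<open>c\<close> as well, because \<open>m + 1 \<le> d\<close> (this is \<open>k \<ge> 2\<close>), and it fails at all \<open>d ^ n\<close>
  branches of depth \<open>n\<close> with probability \<open>(1 - c) ^ (d ^ n)\<close>.
\<close>
lemma complete_occupation_null:
  assumes z: "0 < z" "z \<le> 1" "z \<le> (1 - p) * binomial_tail d m z"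
  shows "prob (complete_occupation G k p) = 0"
proof -
  obtain q where q: "vacant_prob \<longlonglongrightarrow> q" "0 \<le> q" "q \<le> 1" "q = (1 - p) * binomial_tail d m q"
    by (rule vacant_prob_limit)
  have "z \<le> vacant_prob n" for n
  proof (induction n)
    case (Suc n)
    have "(1 - p) * binomial_tail d m z \<le> (1 - p) * binomial_tail d m (vacant_prob n)"
      using Suc z p vacant_prob_bounds(2) by (intro mult_left_mono binomial_tail_mono) auto
    then show ?case using z by simp
  qed (use z in simp)
  then have "z \<le> q" using q(1) by (intro LIMSEQ_le_const) auto
  then have "0 < q" using z by simp
  define c where "c = (1 - p) * binomial_tail d (m + 1) q"
  have "p \<noteq> 1" using z by auto
  then have c: "0 < c"
    unfolding c_def using p k q \<open>0 < q\<close> by (intro mult_pos_pos binomial_tail_pos) auto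
  have "branch_events always_vacant q"
    using branch_events_decreasing_limit[OF branch_events_vacant_within vacant_within_decreasing q(1)]
    by simp
  then have "branch_events block_root c"
    using branch_events_step[of always_vacant q Not "m + 1"]
    by (simp add: block_root_def[abs_def] c_def prob_bernoulli_vacant)
  note defect = branch_events_defect_within[OF this]
  obtain u v where uv: "adjacent G u v" using exists_edge by blast
  have "c \<le> 1"
    using \<open>branch_events block_root c\<close> uv prob_le_1 unfolding branch_events_def by metis
  have bound: "prob (complete_occupation G k p) \<le> (1 - c) ^ n" for n
  proof -
    let ?D = "{\<omega>\<in>space law. defect_within block_root G n u v \<omega>}"
    have D: "?D \<in> events"
      using branch_events_pred[OF defect uv] by (simp add: pred_def)
    have "complete_occupation G k p \<subseteq> space law - ?D"
      using defect_imp_not_complete[OF uv] sets.sets_into_space[OF complete_occupation_events] by auto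
    then have "prob (complete_occupation G k p) \<le> 1 - prob ?D"
      using D by (subst prob_compl[symmetric]) (auto intro: finite_measure_mono)
    also have "prob ?D = 1 - (1 - c) ^ (d ^ n)"
      using defect[of n] uv by (auto simp: branch_events_def)
    also have "1 - (1 - (1 - c) ^ (d ^ n)) = (1 - c) ^ (d ^ n)" by simp
    also have "\<dots> \<le> (1 - c) ^ n"
    proof (rule power_decreasing)
      have "n < 2 ^ n" by (rule less_exp)
      also have "(2::nat) ^ n \<le> d ^ n" using k by (intro power_mono) auto
      finally show "n \<le> d ^ n" by simp
    qed (use c \<open>c \<le> 1\<close> in auto)
    finally show ?thesis .
  qed
  have "(\<lambda>n. (1 - c) ^ n) \<longlonglongrightarrow> 0"
    using c \<open>c \<le> 1\<close> by (intro LIMSEQ_realpow_zero) auto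
  then have "prob (complete_occupation G k p) \<le> 0"
    using bound by (intro LIMSEQ_le_const) auto
  then show ?thesis by (simp add: measure_le_0_iff)
qed

end

section \<open>The critical probability\<close>

text \<open>
  The \<open>p\<close> in \<open>[0, 1]\<close> for which \<open>z = (1 - p) * binomial_tail d m z\<close> has a root \<open>z\<close> strictly between \<open>0\<close>
  and \<open>1\<close>, parametrized by that root.
\<close>
definition critical_values :: "nat \<Rightarrow> nat \<Rightarrow> real set" where
  "critical_values d m = {1 - z / binomial_tail d m z | z. 0 < z \<and> z < 1 \<and> z \<le> binomial_tail d m z}"

lemma critical_valuesI:
  "0 < z \<Longrightarrow> z < 1 \<Longrightarrow> z \<le> binomial_tail d m z \<Longrightarrow> 1 - z / binomial_tail d m z \<in> critical_values d m"
  by (auto simp: critical_values_def)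

lemma root_in_critical_values:
  assumes "0 < z" "z < 1" "z = (1 - p) * binomial_tail d m z" "0 \<le> p"
  shows "p \<in> critical_values d m"
proof -
  let ?F = "binomial_tail d m z"
  have F: "0 < ?F"
    using assms binomial_tail_nonneg[of z d m] by (cases "?F = 0") auto
  then have "1 - z / ?F = p" using assms(3) by (simp add: field_simps)
  moreover have "(1 - p) * ?F \<le> 1 * ?F"
    using assms(4) F by (intro mult_right_mono) auto
  then have "z \<le> ?F" using assms(3) by simp
  ultimately show ?thesis using critical_valuesI[of z d m] assms by simp
qed

text \<open>
  The substitutions are \<open>z = (1 - x) * (1 - p)\<close> and \<open>x = 1 - binomial_tail d (d - k + 1) z\<close>.
\<close>
lemma roots_eq_critical_values:
  assumes k: "k \<le> d"
  shows "{p \<in> {0..1::real}. \<exists>x::real. 0 < x \<and> x < 1 \<and>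
            measure_pmf.prob (binomial_pmf d ((1 - x) * (1 - p))) {j. j \<le> d - k} = x}
       = critical_values d (d - k + 1)" (is "?L = ?R")
proof (intro equalityI subsetI)
  fix p assume "p \<in> ?L"
  then obtain x where p: "0 \<le> p" "p \<le> 1" and x: "0 < x" "x < 1"
    and eq: "measure_pmf.prob (binomial_pmf d ((1 - x) * (1 - p))) {j. j \<le> d - k} = x" by auto
  define z where "z = (1 - x) * (1 - p)"
  have "z \<le> 1 - x" unfolding z_def using p x by (intro mult_left_le) auto
  then have "z < 1" using x by linarith
  moreover have "0 \<le> z" using p x by (simp add: z_def)
  ultimately have z: "0 \<le> z" "z < 1" by simp_all
  have F: "binomial_tail d (d - k + 1) z = 1 - x"
    using eq prob_binomial_le_eq[of z d "d - k"] z by (simp add: z_def)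
  have "z \<noteq> 0" using F x binomial_tail_at_0[of "d - k + 1" d] by auto
  then have "0 < z" using z by linarith
  then show "p \<in> ?R" using z p F by (intro root_in_critical_values) (auto simp: z_def mult.commute)
next
  fix p assume "p \<in> ?R"
  then obtain z where z: "0 < z" "z < 1" "z \<le> binomial_tail d (d - k + 1) z"
    and p: "p = 1 - z / binomial_tail d (d - k + 1) z" by (auto simp: critical_values_def)
  define x where "x = 1 - binomial_tail d (d - k + 1) z"
  have x: "0 < x" "x < 1"
    using z binomial_tail_less_1[of z "d - k + 1" d] by (auto simp: x_def)
  have "(1 - x) * (1 - p) = z" using z by (simp add: x_def p)
  then have "measure_pmf.prob (binomial_pmf d ((1 - x) * (1 - p))) {j. j \<le> d - k} = x"
    using prob_binomial_le_eq[of z d "d - k"] z by (simp add: x_def)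
  moreover have "p \<in> {0..1}" using z by (auto simp: p divide_le_eq)
  ultimately show "p \<in> ?L" using x by auto
qed

lemma critical_values_nonneg: "a \<in> critical_values d m \<Longrightarrow> 0 \<le> a"
  by (auto simp: critical_values_def divide_le_eq)

lemma critical_values_le:
  assumes "a \<in> critical_values d m" "0 < d"
  shows "a \<le> 1 - real m / real d"
proof -
  obtain z where z: "0 < z" "z < 1" "z \<le> binomial_tail d m z" and a: "a = 1 - z / binomial_tail d m z"
    using assms by (auto simp: critical_values_def)
  have "real m * binomial_tail d m z \<le> real d * z"
    using z by (intro binomial_tail_Markov) auto
  then have "real m / real d \<le> z / binomial_tail d m z"
    using z assms(2) by (simp add: field_simps)
  then show ?thesis using a by simp
qed

lemma bdd_above_critical_values: "0 < d \<Longrightarrow> bdd_above (critical_values d m)"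
  using critical_values_le by (meson bdd_aboveI)

lemma binomial_tail_all_but_one:
  "binomial_tail (Suc n) n z = z ^ n * (real n + 1 - real n * z)"
proof -
  have "{n..Suc n} = {n, Suc n}" by auto
  moreover have "Suc n choose n = Suc n" by (metis Suc_eq_plus1 binomial_Suc_n add.commute)
  ultimately show ?thesis by (simp add: binomial_tail_def algebra_simps)
qed

text \<open>
  It suffices to treat \<open>m = d - 1\<close>, where \<open>binomial_tail d m z / z\<close> is \<open>z ^ l * (l + 2 - (l + 1) * z)\<close> with
  \<open>l = d - 2\<close>. At \<open>z = 1 - e\<close> Bernoulli's inequality bounds this below by
  \<open>(1 - l e) (1 + (l + 1) e) = 1 + e - l (l + 1) e\<^sup>2\<close>, which exceeds \<open>1\<close> for small \<open>e\<close>.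
\<close>
lemma critical_values_nonempty:
  assumes "m < d" "2 \<le> d"
  shows "critical_values d m \<noteq> {}"
proof -
  obtain l where d: "d = Suc (Suc l)" using assms(2) by (metis One_nat_def Suc_1 Suc_le_D Suc_le_mono)
  define e where "e = 1 / ((real l + 1) * (real l + 2))"
  have e: "0 < e" "e < 1" "real l * (real l + 1) * e \<le> 1"
    by (auto simp: e_def divide_simps) (auto simp: algebra_simps intro: add_pos_nonneg)
  have "1 + real l * (- e) \<le> (1 + - e) ^ l"
    using e by (intro Bernoulli_inequality) auto
  then have "(1 - real l * e) * (1 + (real l + 1) * e) \<le> (1 - e) ^ l * (1 + (real l + 1) * e)"
    using e by (intro mult_right_mono) auto
  moreover have "(1 - real l * e) * (1 + (real l + 1) * e) = 1 + e * (1 - real l * (real l + 1) * e)"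
    by (simp add: algebra_simps power2_eq_square)
  moreover have "0 \<le> e * (1 - real l * (real l + 1) * e)"
    using e by (intro mult_nonneg_nonneg) auto
  ultimately have "1 \<le> (1 - e) ^ l * (1 + (real l + 1) * e)" by linarith
  then have "(1 - e) * 1 \<le> (1 - e) * ((1 - e) ^ l * (1 + (real l + 1) * e))"
    using e by (intro mult_left_mono) auto
  also have "\<dots> = binomial_tail d (Suc l) (1 - e)"
    unfolding d binomial_tail_all_but_one by (simp add: algebra_simps)
  also have "\<dots> \<le> binomial_tail d m (1 - e)"
    using assms d e by (intro binomial_tail_antimono) auto
  finally show ?thesis using critical_valuesI[of "1 - e" d m] e by auto
qed

text \<open>
  A critical value \<open>a\<close> comes with a \<open>z\<close> that is at most \<open>(1 - b) * binomial_tail d m z\<close> for every \<open>b \<le> a\<close>, so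
  complete occupation is impossible at such \<open>b\<close>; above the supremum there is no root, and complete occupation
  is almost sure.
\<close>
lemma critical_probability_eq_Sup_critical_values:
  assumes tree: "tree G" "regular (d + 1) G" and k: "2 \<le> k" "k \<le> d"
  shows "critical_probability G k = Sup (critical_values d (d - k + 1))"
proof -
  define A where "A = critical_values d (d - k + 1)"
  define B where "B = {p \<in> {0..1}. measure (initial_law G p) (complete_occupation G k p) > 0}"
  have perc: "regular_tree_percolation G d k p" if "0 \<le> p" "p \<le> 1" for p
    using that tree k by unfold_locales
  have A: "A \<noteq> {}" "bdd_above A" "\<And>a. a \<in> A \<Longrightarrow> 0 \<le> a"
    using critical_values_nonempty[of "d - k + 1" d] bdd_above_critical_values[of d] k
    by (auto simp: A_def critical_values_nonneg)
  have "1 \<in> B"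
    using regular_tree_percolation.complete_occupation_almost_surely[OF perc[of 1]]
    by (simp add: B_def)
  have B: "bdd_below B" by (auto simp: B_def bdd_below_def)
  have "a \<le> b" if "a \<in> A" "b \<in> B" for a b
  proof (rule ccontr)
    assume "\<not> a \<le> b"
    obtain z where z: "0 < z" "z < 1" "z \<le> binomial_tail d (d - k + 1) z"
      and a: "a = 1 - z / binomial_tail d (d - k + 1) z"
      using \<open>a \<in> A\<close> by (auto simp: A_def critical_values_def)
    have "z = (1 - a) * binomial_tail d (d - k + 1) z" using z by (simp add: a)
    also have "\<dots> \<le> (1 - b) * binomial_tail d (d - k + 1) z"
      using \<open>\<not> a \<le> b\<close> z by (intro mult_right_mono) auto
    finally have "measure (initial_law G b) (complete_occupation G k b) = 0"
      using \<open>b \<in> B\<close> z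
      by (intro regular_tree_percolation.complete_occupation_null[OF perc, of b z]) (auto simp: B_def)
    then show False using \<open>b \<in> B\<close> by (simp add: B_def)
  qed
  then have "Sup A \<le> Inf B"
    using A(1) \<open>1 \<in> B\<close> by (intro cSup_least cInf_greatest) auto
  moreover have "\<not> Sup A < Inf B"
  proof
    assume less: "Sup A < Inf B"
    define p where "p = (Sup A + Inf B) / 2"
    have "0 \<le> Sup A" using A by (meson cSup_upper2 ex_in_conv)
    moreover have "Inf B \<le> 1" using B \<open>1 \<in> B\<close> by (rule cInf_lower[rotated])
    ultimately have p: "0 < p" "p \<le> 1" "Sup A < p" "p < Inf B" using less by (auto simp: p_def)
    have "z \<noteq> (1 - p) * binomial_tail d (d - k + 1) z" if "0 < z" "z < 1" for z
      using root_in_critical_values[OF that, of p d "d - k + 1"] p cSup_upper[OF _ A(2), of p]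
      by (auto simp: A_def)
    then have "measure (initial_law G p) (complete_occupation G k p) = 1"
      using p by (intro regular_tree_percolation.complete_occupation_almost_surely[OF perc]) auto
    then have "Inf B \<le> p" using p B by (intro cInf_lower) (auto simp: B_def)
    then show False using p by simp
  qed
  ultimately show ?thesis by (simp add: A_def B_def critical_probability_def)
qed

lemma Sup_critical_values_bounds:
  assumes "m < d" "2 \<le> d"
  shows "0 \<le> Sup (critical_values d m)" "Sup (critical_values d m) \<le> 1 - real m / real d"
proof -
  show "Sup (critical_values d m) \<le> 1 - real m / real d"
    using critical_values_nonempty[OF assms] critical_values_le assms by (intro cSup_least) auto
  show "0 \<le> Sup (critical_values d m)"
    using critical_values_nonempty[OF assms] critical_values_nonneg bdd_above_critical_values[of d m] assms
    by (meson cSup_upper2 ex_in_conv less_le_trans zero_less_numeral)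
qed

text \<open>
  A lower bound \<open>t\<close> for the tail is enough to bound the supremum from below.
\<close>
lemma le_Sup_critical_values:
  assumes "0 < d" "0 < z" "z < 1" "z \<le> t" "t \<le> binomial_tail d m z"
  shows "1 - z / t \<le> Sup (critical_values d m)"
proof -
  have "z / binomial_tail d m z \<le> z / t"
    using assms by (intro divide_left_mono mult_pos_pos) auto
  moreover have "1 - z / binomial_tail d m z \<le> Sup (critical_values d m)"
    using assms by (intro cSup_upper critical_valuesI bdd_above_critical_values) auto
  ultimately show ?thesis by linarith
qed

text \<open>
  The upper bound \<open>1 - m / d\<close> comes from Markov's inequality. For the lower one, \<open>z\<close> is fixed slightly
  above \<open>1 - \<gamma>\<close>, the limit of \<open>m / d\<close>; the tail at \<open>z\<close> tends to \<open>1\<close>, and so \<open>1 - z / F z\<close> tends to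
  \<open>1 - z\<close>.
\<close>
lemma Sup_critical_values_tendsto:
  fixes k :: "nat \<Rightarrow> nat"
  assumes \<gamma>: "0 \<le> \<gamma>" "\<gamma> \<le> 1" and k: "\<And>d. 2 \<le> d \<Longrightarrow> 2 \<le> k d \<and> k d \<le> d"
    and lim: "(\<lambda>d. real (k d) / real d) \<longlonglongrightarrow> \<gamma>"
  shows "(\<lambda>d. Sup (critical_values d (d - k d + 1))) \<longlonglongrightarrow> \<gamma>"
proof (rule tendstoI)
  fix \<epsilon> :: real assume \<epsilon>: "0 < \<epsilon>"
  have upper: "\<forall>\<^sub>F d in sequentially. real (k d) / real d < \<gamma> + \<epsilon>"
    using lim \<epsilon> by (intro order_tendstoD) auto
  have nonneg: "0 \<le> Sup (critical_values d (d - k d + 1))"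
    and le: "Sup (critical_values d (d - k d + 1)) \<le> real (k d) / real d" if "2 \<le> d" for d
  proof -
    have m: "d - k d + 1 < d" using k[OF that] by linarith
    have "1 - real (d - k d + 1) / real d \<le> real (k d) / real d"
      using that k[OF that] by (simp add: of_nat_diff field_simps)
    then show "0 \<le> Sup (critical_values d (d - k d + 1))"
      "Sup (critical_values d (d - k d + 1)) \<le> real (k d) / real d"
      using Sup_critical_values_bounds[OF m that] by linarith+
  qed
  have lower: "\<forall>\<^sub>F d in sequentially. \<gamma> - \<epsilon> < Sup (critical_values d (d - k d + 1))"
  proof (cases "\<gamma> < \<epsilon>")
    case True
    show ?thesis
      using eventually_ge_at_top[of 2] by eventually_elim (use True nonneg in fastforce)
  next
    case False
    define z where "z = 1 - \<gamma> + \<epsilon> / 2"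
    define h where "h d = 1 - exp (- 2 * real d * (\<epsilon> / 4)\<^sup>2)" for d
    have z: "0 < z" "z < 1" using False \<epsilon> \<gamma> by (auto simp: z_def)
    have h: "h \<longlonglongrightarrow> 1" unfolding h_def using \<epsilon> by real_asymp
    have "\<forall>\<^sub>F d in sequentially. z < h d"
      using h z by (intro order_tendstoD) auto
    moreover have "(\<lambda>d. 1 - z / h d) \<longlonglongrightarrow> 1 - z / 1"
      using h by (intro tendsto_intros) auto
    then have "\<forall>\<^sub>F d in sequentially. \<gamma> - \<epsilon> < 1 - z / h d"
      by (rule order_tendstoD) (use \<epsilon> in \<open>simp add: z_def\<close>)
    moreover have "(\<lambda>d. real (k d) / real d - 1 / real d) \<longlonglongrightarrow> \<gamma> - 0"
      using lim by (intro tendsto_intros lim_1_over_n)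
    then have "\<forall>\<^sub>F d in sequentially. \<gamma> - \<epsilon> / 4 < real (k d) / real d - 1 / real d"
      by (rule order_tendstoD) (use \<epsilon> in simp)
    ultimately show ?thesis
      using eventually_ge_at_top[of 2]
    proof eventually_elim
      case (elim d)
      have "real (d - k d + 1) = real d * (1 - (real (k d) / real d - 1 / real d))"
        using elim(4) k[OF elim(4)] by (simp add: of_nat_diff field_simps)
      also have "\<dots> \<le> real d * (z - \<epsilon> / 4)"
        using elim(3) by (intro mult_left_mono) (auto simp: z_def)
      finally have "h d \<le> binomial_tail d (d - k d + 1) z"
        unfolding h_def using z elim(4) \<epsilon> by (intro binomial_tail_Hoeffding) auto
      then have "1 - z / h d \<le> Sup (critical_values d (d - k d + 1))"
        using z elim by (intro le_Sup_critical_values) auto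
      then show ?case using elim(2) by linarith
    qed
  qed
  show "\<forall>\<^sub>F d in sequentially. dist (Sup (critical_values d (d - k d + 1))) \<gamma> < \<epsilon>"
    using upper lower eventually_ge_at_top[of 2]
    by eventually_elim (use le in \<open>fastforce simp: dist_real_def abs_less_iff\<close>)
qed

text \<open>
  As \<open>z\<close> tends to \<open>0\<close>, \<open>1 - (1 - z) ^ d\<close> behaves like \<open>d z\<close>. Explicitly, Bernoulli's inequality
  gives \<open>(1 - z) ^ d * (1 + d z) \<le> (1 - z\<^sup>2) ^ d \<le> 1\<close>, so the tail is at least \<open>t = d z / (1 + d z)\<close>, and
  \<open>z / t = 1 / d + z\<close>.
\<close>
lemma Sup_critical_values_1:
  assumes "2 \<le> d"
  shows "Sup (critical_values d 1) = 1 - 1 / real d"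
proof (rule antisym)
  show "Sup (critical_values d 1) \<le> 1 - 1 / real d"
    using Sup_critical_values_bounds(2)[of 1 d] assms by simp
  show "1 - 1 / real d \<le> Sup (critical_values d 1)"
  proof (rule field_le_epsilon)
    fix e :: real assume e: "0 < e"
    \<comment> \<open>\<open>z \<le> 1 / 2\<close> yields \<open>1 + d z \<le> d\<close>, and with it the admissibility of \<open>z\<close>\<close>
    define z where "z = min e (1 / 2)"
    define t where "t = real d * z / (1 + real d * z)"
    have z: "0 < z" "z \<le> e" "z \<le> 1 / 2" "z < 1" using e by (auto simp: z_def)
    have dz: "0 < real d * z" using z assms by simp
    have "(1 - z) ^ d * (1 + real d * z) \<le> (1 - z) ^ d * (1 + z) ^ d"
      using z by (intro mult_left_mono Bernoulli_inequality) auto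
    also have "\<dots> = (1 - z\<^sup>2) ^ d"
      by (simp add: power_mult_distrib[symmetric] algebra_simps power2_eq_square)
    also have "\<dots> \<le> 1" using z by (intro power_le_one) (auto simp: power_le_one)
    finally have "t \<le> binomial_tail d 1 z"
      using dz by (simp add: t_def binomial_tail_1 field_simps)
    moreover have "real d * z \<le> real d / 2" "2 \<le> real d"
      using z assms by simp_all
    then have "1 + real d * z \<le> real d" by linarith
    then have "z * (1 + real d * z) \<le> z * real d"
      using z by (intro mult_left_mono) auto
    then have "z \<le> t" using dz by (simp add: t_def field_simps)
    ultimately have "1 - z / t \<le> Sup (critical_values d 1)"
      using z assms by (intro le_Sup_critical_values) auto
    moreover have "z / t = 1 / real d + z"
      using dz z assms by (simp add: t_def field_simps)
    ultimately show "1 - 1 / real d \<le> Sup (critical_values d 1) + e" using z by linarith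
  qed
qed

text \<open>
  The left-hand side attains its maximum over \<open>t \<ge> 0\<close> at \<open>t = 1\<close>. The induction step rests on
  \<open>(t - 1) * (t ^ (n + 1) - 1) \<ge> 0\<close>.
\<close>
lemma power_times_affine_le_1:
  fixes t :: real
  assumes "0 \<le> t"
  shows "t ^ n * (real n + 1 - real n * t) \<le> 1"
proof (induction n)
  case (Suc n)
  have "0 \<le> (t - 1) * (t ^ Suc n - 1)"
  proof (cases "1 \<le> t")
    case True
    then show ?thesis by (intro mult_nonneg_nonneg) (auto simp del: power_Suc simp: one_le_power)
  next
    case False
    then show ?thesis using assms
      by (intro mult_nonpos_nonpos) (auto simp del: power_Suc simp: power_le_one)
  qed
  moreover have "0 \<le> t * (1 - t ^ n * (real n + 1 - real n * t))"
    using Suc assms by (intro mult_nonneg_nonneg) auto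
  ultimately show ?case by (simp add: algebra_simps)
qed simp

text \<open>
  The supremum is \<open>1 - 1 / g\<close> with \<open>g\<close> the maximum of \<open>binomial_tail d (d - 1) z / z\<close>. Rescaling by the
  maximizer \<open>z0\<close> reduces the maximality of \<open>g\<close> to \<open>power_times_affine_le_1\<close>. For \<open>d = 2\<close> the maximizer would be
  \<open>0\<close>, which is not admissible; the supremum is then a limit and comes from the case \<open>m = 1\<close>.
\<close>
lemma Sup_critical_values_all_but_one:
  assumes "2 \<le> d"
  shows "Sup (critical_values d (d - 1)) =
           1 - (real d - 1) ^ (2 * d - 3) / (real d ^ (d - 1) * (real d - 2) ^ (d - 2))"
proof (cases "d = 2")
  case True
  then show ?thesis using Sup_critical_values_1[of 2] by simp
next
  case False
  then obtain l where d: "d = l + 2" "0 < l"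
    using assms by (metis add.commute le_add_diff_inverse nat_less_le gr0I add_0)
  define r where "r = real l"
  have r: "0 < r" using d by (simp add: r_def)
  define z0 where "z0 = (r + 2) * r / (r + 1)\<^sup>2"
  define g where "g = (r + 2) ^ (l + 1) * r ^ l / (r + 1) ^ (2 * l + 1)"
  have "(r + 2) * r < (r + 1)\<^sup>2" by (simp add: power2_eq_square algebra_simps)
  then have z0: "0 < z0" "z0 < 1"
    using r by (simp_all add: z0_def)
  have tail: "binomial_tail d (d - 1) z = z * (z ^ l * (r + 2 - (r + 1) * z))" for z
    using binomial_tail_all_but_one[of "Suc l" z] by (simp add: d r_def algebra_simps)
  have g: "g = z0 ^ l * ((r + 2) / (r + 1))"
    using r by (simp add: g_def z0_def power_mult_distrib power_divide power_mult[symmetric] mult.commute)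
  have affine: "r + 2 - (r + 1) * (z0 * t) = (r + 2) / (r + 1) * (r + 1 - r * t)" for t
  proof -
    have "(r + 2) / (r + 1) * (r + 1) = r + 2" using r by simp
    moreover have "(r + 1) * (z0 * t) = (r + 2) / (r + 1) * (r * t)"
      using r by (simp add: z0_def power2_eq_square divide_simps)
    ultimately show ?thesis by (simp only: right_diff_distrib)
  qed
  have gle: "z ^ l * (r + 2 - (r + 1) * z) \<le> g" if "0 \<le> z" for z
  proof -
    define t where "t = z / z0"
    have t: "z = z0 * t" "0 \<le> t" using z0 that by (auto simp: t_def)
    have "z ^ l * (r + 2 - (r + 1) * z) = g * (t ^ l * (r + 1 - r * t))"
      unfolding t(1) g affine power_mult_distrib by (simp only: mult_ac)
    also have "\<dots> \<le> g * 1"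
      using power_times_affine_le_1[OF t(2), of l] z0 r
      by (intro mult_left_mono) (auto simp: g r_def add.commute)
    finally show ?thesis by simp
  qed
  have gz0: "z0 ^ l * (r + 2 - (r + 1) * z0) = g"
    using affine[of 1] unfolding g by simp
  have "g > 0" using z0 r by (simp add: g)
  have "critical_values d (d - 1) \<noteq> {}"
    using assms by (intro critical_values_nonempty) auto
  then obtain z where z: "0 < z" "z < 1" "z \<le> binomial_tail d (d - 1) z"
    by (auto simp: critical_values_def)
  \<comment> \<open>any critical value shows that the maximum \<open>g\<close> is at least \<open>1\<close>, so that \<open>z0\<close> is admissible\<close>
  have "z * 1 \<le> z * (z ^ l * (r + 2 - (r + 1) * z))"
    using z(3) unfolding tail mult_1_right .
  then have "1 \<le> z ^ l * (r + 2 - (r + 1) * z)"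
    using z(1) by (rule mult_left_le_imp_le)
  also have "\<dots> \<le> g" using gle z by simp
  finally have "1 \<le> g" .
  have "Sup (critical_values d (d - 1)) = 1 - 1 / g"
  proof (rule cSup_eq_maximum)
    have tail_z0: "binomial_tail d (d - 1) z0 = z0 * g" unfolding tail gz0 ..
    have "z0 \<le> binomial_tail d (d - 1) z0" unfolding tail_z0 using z0 \<open>1 \<le> g\<close> by simp
    then have "1 - z0 / binomial_tail d (d - 1) z0 \<in> critical_values d (d - 1)"
      using z0 by (intro critical_valuesI)
    then show "1 - 1 / g \<in> critical_values d (d - 1)"
      unfolding tail_z0 using z0 by simp
  next
    fix a assume "a \<in> critical_values d (d - 1)"
    then obtain z where z: "0 < z" "z < 1" "z \<le> binomial_tail d (d - 1) z"
      and a: "a = 1 - z / binomial_tail d (d - 1) z" by (auto simp: critical_values_def)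
    have "binomial_tail d (d - 1) z \<le> z * g"
      unfolding tail using z gle by (intro mult_left_mono) auto
    then have "1 / g \<le> z / binomial_tail d (d - 1) z"
      using z \<open>g > 0\<close> by (simp add: field_simps)
    then show "a \<le> 1 - 1 / g" using a by simp
  qed
  also have "1 / g = (real d - 1) ^ (2 * d - 3) / (real d ^ (d - 1) * (real d - 2) ^ (d - 2))"
    by (simp add: g_def d r_def add.commute)
  finally show ?thesis .
qed

lemma critical_value_two_asymptotics:
  "(\<lambda>d. 1 - (real d - 1) ^ (2 * d - 3) / (real d ^ (d - 1) * (real d - 2) ^ (d - 2)))
     \<sim>[at_top] (\<lambda>d. 1 / (2 * real d ^ 2))"
proof -
  \<comment> \<open>powers with varying exponents in exponential form, for the sake of \<open>real_asymp\<close>\<close>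
  have "(\<lambda>d. 1 - exp ((2 * real d - 3) * ln (real d - 1) - (real d - 1) * ln (real d)
                    - (real d - 2) * ln (real d - 2)))
     \<sim>[at_top] (\<lambda>d. 1 / (2 * real d ^ 2))"
    by real_asymp
  moreover have "\<forall>\<^sub>F d in at_top.
        1 - exp ((2 * real d - 3) * ln (real d - 1) - (real d - 1) * ln (real d)
               - (real d - 2) * ln (real d - 2))
      = 1 - (real d - 1) ^ (2 * d - 3) / (real d ^ (d - 1) * (real d - 2) ^ (d - 2))"
    using eventually_ge_at_top[of 3]
  proof eventually_elim
    case (elim d)
    have pow: "exp (real n * ln x) = x ^ n" if "0 < x" for n and x :: real
      using that by (simp add: exp_of_nat_mult)
    have "exp ((2 * real d - 3) * ln (real d - 1)) = (real d - 1) ^ (2 * d - 3)"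
      "exp ((real d - 1) * ln (real d)) = real d ^ (d - 1)"
      "exp ((real d - 2) * ln (real d - 2)) = (real d - 2) ^ (d - 2)"
      using elim pow[of "real d - 1" "2 * d - 3"] pow[of "real d" "d - 1"] pow[of "real d - 2" "d - 2"]
      by (simp_all add: of_nat_diff)
    then show ?case by (simp add: exp_diff)
  qed
  ultimately show ?thesis by (rule asymp_equiv_transfer) simp
qed

theorem proposition1p2:
  fixes T :: "nat \<Rightarrow> 'v ugraph"
  assumes T: "\<And>d. d \<ge> 2 \<Longrightarrow> infinite_regular_tree (d + 1) (T d)"
  shows
    "(\<forall>d k. 2 \<le> k \<and> k \<le> d \<longrightarrow>
        critical_probability (T d) k =
          Sup {p \<in> {0..1::real}. \<exists>x::real. 0 < x \<and> x < 1 \<and>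
                 measure_pmf.prob (binomial_pmf d ((1 - x) * (1 - p))) {j. j \<le> d - k} = x})
     \<and>
     (\<forall>\<gamma>\<in>{0..1::real}. \<forall>k :: nat \<Rightarrow> nat.
        (\<forall>d\<ge>2. 2 \<le> k d \<and> k d \<le> d) \<longrightarrow>
        (\<lambda>d. real (k d) / real d) \<longlonglongrightarrow> \<gamma> \<longrightarrow>
        (\<lambda>d. critical_probability (T d) (k d)) \<longlonglongrightarrow> \<gamma>)
     \<and>
     (\<forall>d\<ge>2. critical_probability (T d) d = 1 - 1 / real d \<and>
        critical_probability (T d) 2 =
          1 - (real d - 1) ^ (2 * d - 3) / (real d ^ (d - 1) * (real d - 2) ^ (d - 2)))
     \<and>
     (\<lambda>d. critical_probability (T d) 2) \<sim>[at_top] (\<lambda>d. 1 / (2 * real d ^ 2))"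
proof (intro conjI)
  have crit: "critical_probability (T d) k = Sup (critical_values d (d - k + 1))"
    if "2 \<le> k" "k \<le> d" for d k
    using T[of d] that
    by (intro critical_probability_eq_Sup_critical_values) (auto simp: infinite_regular_tree_def)
  have crit_two: "critical_probability (T d) 2 =
      1 - (real d - 1) ^ (2 * d - 3) / (real d ^ (d - 1) * (real d - 2) ^ (d - 2))" if "2 \<le> d" for d
  proof -
    have "d - 2 + 1 = d - 1" using that by simp
    then show ?thesis using crit[of 2 d] Sup_critical_values_all_but_one[OF that] that by simp
  qed
  show "\<forall>d k. 2 \<le> k \<and> k \<le> d \<longrightarrow>
        critical_probability (T d) k =
          Sup {p \<in> {0..1::real}. \<exists>x::real. 0 < x \<and> x < 1 \<and>
                 measure_pmf.prob (binomial_pmf d ((1 - x) * (1 - p))) {j. j \<le> d - k} = x}"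
    using crit roots_eq_critical_values by presburger
  show "\<forall>\<gamma>\<in>{0..1::real}. \<forall>k :: nat \<Rightarrow> nat.
        (\<forall>d\<ge>2. 2 \<le> k d \<and> k d \<le> d) \<longrightarrow>
        (\<lambda>d. real (k d) / real d) \<longlonglongrightarrow> \<gamma> \<longrightarrow>
        (\<lambda>d. critical_probability (T d) (k d)) \<longlonglongrightarrow> \<gamma>"
  proof (intro ballI allI impI)
    fix \<gamma> :: real and k :: "nat \<Rightarrow> nat"
    assume \<gamma>: "\<gamma> \<in> {0..1}" and k: "\<forall>d\<ge>2. 2 \<le> k d \<and> k d \<le> d"
      and lim: "(\<lambda>d. real (k d) / real d) \<longlonglongrightarrow> \<gamma>"
    have "\<forall>\<^sub>F d in sequentially. Sup (critical_values d (d - k d + 1)) = critical_probability (T d) (k d)"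
      using eventually_ge_at_top[of 2] by eventually_elim (use crit k in simp)
    moreover have "(\<lambda>d. Sup (critical_values d (d - k d + 1))) \<longlonglongrightarrow> \<gamma>"
      using \<gamma> k lim by (intro Sup_critical_values_tendsto) auto
    ultimately show "(\<lambda>d. critical_probability (T d) (k d)) \<longlonglongrightarrow> \<gamma>"
      by (rule Lim_transform_eventually[rotated])
  qed
  show "\<forall>d\<ge>2. critical_probability (T d) d = 1 - 1 / real d \<and>
        critical_probability (T d) 2 =
          1 - (real d - 1) ^ (2 * d - 3) / (real d ^ (d - 1) * (real d - 2) ^ (d - 2))"
    using crit Sup_critical_values_1 crit_two by simp
  have "\<forall>\<^sub>F d in at_top.
      1 - (real d - 1) ^ (2 * d - 3) / (real d ^ (d - 1) * (real d - 2) ^ (d - 2))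
      = critical_probability (T d) 2"
    using eventually_ge_at_top[of 2] by eventually_elim (simp add: crit_two)
  then show "(\<lambda>d. critical_probability (T d) 2) \<sim>[at_top] (\<lambda>d. 1 / (2 * real d ^ 2))"
    by (rule asymp_equiv_transfer[OF critical_value_two_asymptotics]) simp
qed

end
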